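(* Let $\mathcal{C}\subseteq\mathbb{F}_2^n$ be a binary linear code of length $n$, let $w:\{1,\ldots,n\}\to\mathbb{R}$ be a real weight function and let $W_{\mathcal{C},w}(z)=\sum_{c\in\mathcal{C}}z^{w(c)}$ be its weight enumerator (where $w(c)$ is the sum of $w(i)$ over the nonzero entries $c_i$ of $c$). Then one can construct in polynomial time a directed 4-hypergraph $D=(V,A)$ and a weight function $t:A\to\mathbb{R}$ such that $$W_{\mathcal{C},w}(z)=\pm\det(I+A'),$$ where $A'$ is a signing of the adjacency 4-matrix $A(D,t,z)$, i.e. is obtained from $A(D,t,z)$ by multiplying some entries by $-1$, and $I$ is the 4-dimensional identity matrix on $V$.
   Context: A directed 4-hypergraph is a pair $D=(V,A)$ with $V$ finite and $A$ a set of ordered 4-tuples of pairwise distinct vertices of $V$. Its adjacency 4-matrix $A(D,t,z)$ is the array indexed by $V^4$ whose entry at $a\in A$ is $z^{t(a)}$ and whose other entries are $0$ ($z$ a formal variable). The identity 4-matrix $I$ has entry $1$ at each $(v,v,v,v)$, $v\in V$, and $0$ elsewhere. For a 4-matrix $M$ indexed by $V^4$ (with $V$ linearly ordered), $\det(M)=\sum_{\alpha_1,\alpha_2,\alpha_3}\mathrm{sign}(\alpha_1)\mathrm{sign}(\alpha_2)\mathrm{sign}(\alpha_3)\prod_{i\in V}M_{(\alpha_1(i),\alpha_2(i),\alpha_3(i),i)}$, the sum over all triples of permutations of $V$. *)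

theory Defs
  imports
    "HOL-Library.Z2"
    "HOL-Library.Poly_Mapping"
    "HOL-Combinatorics.Permutations"
    "HOL-Computational_Algebra.Polynomial"
    "Jordan_Normal_Form.VS_Connect"
begin

section \<open>Binary linear codes\<close>

definition linear_code :: "nat \<Rightarrow> bit vec set \<Rightarrow> bool" where
  "linear_code n C \<longleftrightarrow> subspace class_ring C (module_vec TYPE(bit) n)"

text \<open>The rows of a generator matrix form a basis of the code.\<close>

definition generator_matrix :: "nat \<Rightarrow> nat \<Rightarrow> bit mat \<Rightarrow> bit vec set \<Rightarrow> bool" where
  "generator_matrix k n G C \<longleftrightarrow>
     G \<in> carrier_mat k n \<and>
     distinct (rows G) \<and>
     module.lin_indpt class_ring (module_vec TYPE(bit) n) (set (rows G)) \<and>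
     C = vec_space.row_space n G"

text \<open>
  The weight enumerator is a formal expression in a variable \<open>z\<close> with real exponents. It is an
  element of the group ring of \<open>(\<real>, +)\<close> over the integers, i.e. of the finitely supported
  functions from exponents to coefficients with convolution as product; \<open>zpow r\<close> is \<open>z\<close> to
  the power \<open>r\<close>.
\<close>

type_synonym gpoly = "real \<Rightarrow>\<^sub>0 int"

definition zpow :: "real \<Rightarrow> gpoly" where
  "zpow r = Poly_Mapping.single r 1"

text \<open>Coordinates are \<open>0, \<dots>, n - 1\<close>.\<close>

definition code_weight :: "(nat \<Rightarrow> real) \<Rightarrow> bit vec \<Rightarrow> real" where
  "code_weight w c = (\<Sum>i | i < dim_vec c \<and> c $ i \<noteq> 0. w i)"

definition weight_enumerator :: "bit vec set \<Rightarrow> (nat \<Rightarrow> real) \<Rightarrow> gpoly" where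
  "weight_enumerator C w = (\<Sum>c\<in>C. zpow (code_weight w c))"


section \<open>Directed 4-hypergraphs and 4-matrices\<close>

type_synonym 'v arc = "'v \<times> 'v \<times> 'v \<times> 'v"

definition directed_4hypergraph :: "'v set \<Rightarrow> 'v arc set \<Rightarrow> bool" where
  "directed_4hypergraph V A \<longleftrightarrow>
     finite V \<and> (\<forall>(a, b, c, d) \<in> A. {a, b, c, d} \<subseteq> V \<and> distinct [a, b, c, d])"

text \<open>
  A 4-matrix indexed by \<open>V\<^sup>4\<close> is a function on all 4-tuples of which only the values on
  \<open>V \<times> V \<times> V \<times> V\<close> matter.
\<close>

type_synonym ('v, 'r) mat4 = "'v \<times> 'v \<times> 'v \<times> 'v \<Rightarrow> 'r"

definition adjacency4 :: "'v arc set \<Rightarrow> ('v arc \<Rightarrow> real) \<Rightarrow> ('v, gpoly) mat4" where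
  "adjacency4 A t = (\<lambda>a. if a \<in> A then zpow (t a) else 0)"

definition identity4 :: "('v, 'r :: zero_neq_one) mat4" where
  "identity4 = (\<lambda>(a, b, c, d). if a = b \<and> b = c \<and> c = d then 1 else 0)"

definition is_signing :: "('v, 'r :: uminus) mat4 \<Rightarrow> ('v, 'r) mat4 \<Rightarrow> bool" where
  "is_signing M' M \<longleftrightarrow> (\<forall>a. M' a = M a \<or> M' a = - M a)"

definition det4 :: "'v set \<Rightarrow> ('v, 'r :: comm_ring_1) mat4 \<Rightarrow> 'r" where
  "det4 V M =
     (\<Sum>\<alpha>\<^sub>1 | \<alpha>\<^sub>1 permutes V. \<Sum>\<alpha>\<^sub>2 | \<alpha>\<^sub>2 permutes V. \<Sum>\<alpha>\<^sub>3 | \<alpha>\<^sub>3 permutes V.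
        of_int (sign \<alpha>\<^sub>1 * sign \<alpha>\<^sub>2 * sign \<alpha>\<^sub>3) * (\<Prod>i\<in>V. M (\<alpha>\<^sub>1 i, \<alpha>\<^sub>2 i, \<alpha>\<^sub>3 i, i)))"


section \<open>The model of computation\<close>

text \<open>
  Polynomial time refers to a random access machine, presented as a while language. A state has
  scalar natural-number registers, natural-number arrays and real arrays. Registers and arrays are
  named by numerals fixed in the program; array cells are addressed indirectly.

  Every assignment and every test costs one unit. The number of operations in an expression is
  bounded by a constant of the program, so charging for them separately changes the time by a
  constant factor only. There is no multiplication: the bit length of the numbers in a run grows at
  most linearly with the time, so that polynomial time under this unit cost is the same as under
  logarithmic cost, i.e. the same as Turing machine polynomial time.

  Weights are arbitrary real numbers and sit in separate real cells. They can be copied, added,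
  subtracted and compared; the only real constant is 0. There is no conversion between real and
  natural numbers, and no real multiplication or rounding.
\<close>

datatype nexp =
    NConst nat
  | NReg nat
  | NArr nat nexp
  | NPlus nexp nexp
  | NMinus nexp nexp

datatype rexp =
    RZero
  | RArr nat nexp
  | RPlus rexp rexp
  | RMinus rexp rexp

datatype bexp =
    NLess nexp nexp
  | RLess rexp rexp
  | Neg bexp
  | Conj bexp bexp

datatype com =
    Skip
  | SetReg nat nexp
  | SetArr nat nexp nexp
  | SetRArr nat nexp rexp
  | Seq com com
  | Cond bexp com com
  | While bexp com

record ram_state =
  reg :: "nat \<Rightarrow> nat"
  arr :: "nat \<Rightarrow> nat \<Rightarrow> nat"
  rarr :: "nat \<Rightarrow> nat \<Rightarrow> real"

text \<open>Subtraction of natural numbers is truncated.\<close>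

primrec nval :: "nexp \<Rightarrow> ram_state \<Rightarrow> nat" where
  "nval (NConst m) s = m"
| "nval (NReg x) s = reg s x"
| "nval (NArr x e) s = arr s x (nval e s)"
| "nval (NPlus e e') s = nval e s + nval e' s"
| "nval (NMinus e e') s = nval e s - nval e' s"

primrec rval :: "rexp \<Rightarrow> ram_state \<Rightarrow> real" where
  "rval RZero s = 0"
| "rval (RArr x e) s = rarr s x (nval e s)"
| "rval (RPlus e e') s = rval e s + rval e' s"
| "rval (RMinus e e') s = rval e s - rval e' s"

primrec bval :: "bexp \<Rightarrow> ram_state \<Rightarrow> bool" where
  "bval (NLess e e') s \<longleftrightarrow> nval e s < nval e' s"
| "bval (RLess e e') s \<longleftrightarrow> rval e s < rval e' s"
| "bval (Neg b) s \<longleftrightarrow> \<not> bval b s"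
| "bval (Conj b b') s \<longleftrightarrow> bval b s \<and> bval b' s"

text \<open>\<open>exec P s T s'\<close>: started in \<open>s\<close>, the program \<open>P\<close> halts in \<open>s'\<close> after time \<open>T\<close>.\<close>

inductive exec :: "com \<Rightarrow> ram_state \<Rightarrow> nat \<Rightarrow> ram_state \<Rightarrow> bool" where
  exec_Skip: "exec Skip s 1 s"
| exec_SetReg: "exec (SetReg x e) s 1 (s\<lparr>reg := (reg s)(x := nval e s)\<rparr>)"
| exec_SetArr:
    "exec (SetArr x i e) s 1
       (s\<lparr>arr := (arr s)(x := (arr s x)(nval i s := nval e s))\<rparr>)"
| exec_SetRArr:
    "exec (SetRArr x i e) s 1
       (s\<lparr>rarr := (rarr s)(x := (rarr s x)(nval i s := rval e s))\<rparr>)"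
| exec_Seq: "exec c s T s' \<Longrightarrow> exec c' s' T' s'' \<Longrightarrow> exec (Seq c c') s (T + T') s''"
| exec_CondTrue: "bval b s \<Longrightarrow> exec c s T s' \<Longrightarrow> exec (Cond b c c') s (T + 1) s'"
| exec_CondFalse: "\<not> bval b s \<Longrightarrow> exec c' s T s' \<Longrightarrow> exec (Cond b c c') s (T + 1) s'"
| exec_WhileFalse: "\<not> bval b s \<Longrightarrow> exec (While b c) s 1 s"
| exec_WhileTrue:
    "bval b s \<Longrightarrow> exec c s T s' \<Longrightarrow> exec (While b c) s' T' s'' \<Longrightarrow>
     exec (While b c) s (T + T' + 1) s''"


section \<open>Input and output\<close>

text \<open>
  Input: the length \<open>n\<close> and the dimension \<open>k\<close> in registers 0 and 1, the generator matrix row by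
  row in array 0, the weights in real array 0. All other cells are 0.
\<close>

definition input_state :: "nat \<Rightarrow> nat \<Rightarrow> bit mat \<Rightarrow> (nat \<Rightarrow> real) \<Rightarrow> ram_state" where
  "input_state k n G w =
     \<lparr> reg = (\<lambda>x. if x = 0 then n else if x = 1 then k else 0),
       arr = (\<lambda>x a. if x = 0 \<and> a < k * n \<and> G $$ (a div n, a mod n) = 1 then 1 else 0),
       rarr = (\<lambda>x a. if x = 0 \<and> a < n then w a else 0) \<rparr>"

text \<open>The number of cells occupied by the input.\<close>

definition input_size :: "nat \<Rightarrow> nat \<Rightarrow> nat" where
  "input_size k n = 2 + k * n + n"

text \<open>
  Output: the vertices are \<open>0, \<dots>, N - 1\<close> with \<open>N\<close> in register 0, and register 1 holds the
  number \<open>m\<close> of arcs. The \<open>j\<close>-th arc, for \<open>j < m\<close>, has its four vertices in cell \<open>j\<close> of the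
  arrays 0, 1, 2, 3 and its weight in cell \<open>j\<close> of real array 0; no arc is listed twice.
\<close>

definition output_arc :: "ram_state \<Rightarrow> nat \<Rightarrow> nat arc" where
  "output_arc s j = (arr s 0 j, arr s 1 j, arr s 2 j, arr s 3 j)"

definition outputs :: "ram_state \<Rightarrow> nat set \<Rightarrow> nat arc set \<Rightarrow> (nat arc \<Rightarrow> real) \<Rightarrow> bool" where
  "outputs s V A t \<longleftrightarrow>
     V = {..<reg s 0} \<and>
     A = output_arc s ` {..<reg s 1} \<and>
     inj_on (output_arc s) {..<reg s 1} \<and>
     (\<forall>j < reg s 1. t (output_arc s j) = rarr s 0 j)"

text \<open>
  The program \<open>P\<close> constructs \<open>(V, A)\<close> and \<open>t\<close> from the input within the time bound \<open>B\<close>. The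
  bound on the size of \<open>(V, A)\<close> is separate because \<open>V\<close> is output only as the number of its
  elements.
\<close>

definition constructs_within ::
  "com \<Rightarrow> nat \<Rightarrow> ram_state \<Rightarrow> nat set \<Rightarrow> nat arc set \<Rightarrow> (nat arc \<Rightarrow> real) \<Rightarrow> bool" where
  "constructs_within P B s V A t \<longleftrightarrow>
     (\<exists>T s'. exec P s T s' \<and> T \<le> B \<and> outputs s' V A t \<and> card V + card A \<le> B)"

end

(*
  Sum over subsets of four permutations: det(I + A') is the sum over all sets T of vertices of the
  4-determinant of A' on T. Choose A'(a, b, c, d) nonzero only if b = tau(d) and d = tau(c) for a
  fixed permutation tau; then only tau-invariant sets T survive, the signs of tau and its inverse
  on T cancel, and the first coordinate contributes the principal minor on T of an ordinary matrix
  K. For K take a disjoint union of tournaments, i.e. skew-symmetric matrices with entries +1 above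
  and -1 below the diagonal: a principal minor of a tournament is 1 or 0 according to the parity of
  its size. So K enforces parity checks, and tau enforces that the copies of one bit in different
  checks agree. The invariant sets with even blocks are then in bijection with the codewords.
*)
theory Submission
  imports Defs
begin

section \<open>Principal minors of tournament matrices\<close>

text \<open>The obstacle is that the four vertices of an arc must be distinct. An arc has
  \<open>b = \<tau> d\<close>, \<open>d = \<tau> c\<close> and \<open>a\<close> in the block of
  \<open>d\<close>; it is proper once \<open>\<tau>\<close> has no point of period two and always
  moves a vertex to another block. With a single copy per coordinate, the coordinate cycles would be
  fixed points and the row cycles of short codes too short; hence four copies of every bit, and four
  identical checks per coordinate. A zero entry of the generator matrix must stay out of all checks,
  yet its vertices need even blocks. Pairing copies at distance two yields blocks that lie inside
  one cycle, hence are taken entirely or not at all, and that still separate neighbours on the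
  cycle. Independence of the generator rows makes sets of rows, rather than codewords, the summation
  index. A vertex of a chosen set is the fourth vertex of exactly one arc in each product, so a
  weight attached to the fourth vertex is counted once.\<close>

definition principal_minor :: "('v \<Rightarrow> 'v \<Rightarrow> int) \<Rightarrow> 'v set \<Rightarrow> int" where
  "principal_minor K T = (\<Sum>\<alpha> | \<alpha> permutes T. sign \<alpha> * (\<Prod>d\<in>T. K (\<alpha> d) d))"

text \<open>A fixed point \<open>x\<close> of \<open>g\<close> satisfies \<open>f x = - f x\<close>
  and contributes 0, so over the integers the involution may have fixed points.\<close>

lemma sum_eq_0_by_involution:
  fixes f :: "'a \<Rightarrow> int"
  assumes "\<And>x. x \<in> P \<Longrightarrow> g x \<in> P" "\<And>x. x \<in> P \<Longrightarrow> g (g x) = x"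
    and "\<And>x. x \<in> P \<Longrightarrow> f (g x) = - f x"
  shows "sum f P = 0"
proof -
  have "sum f P = (\<Sum>x\<in>P. f (g x))"
    by (rule sum.reindex_bij_witness[where i = g and j = g]) (use assms in auto)
  also have "\<dots> = - sum f P"
    by (simp add: assms(3) sum_negf)
  finally show ?thesis by simp
qed

lemma sign_transpose_comp:
  assumes "finite T" "\<alpha> permutes T" "a \<noteq> b"
  shows "sign (transpose a b \<circ> \<alpha>) = - sign \<alpha>"
  using assms by (auto simp: sign_compose permutation_swap_id permutes_imp_permutation sign_swap_id)

lemma sign_transpose_conj:
  assumes "finite T" "\<alpha> permutes T" "a \<noteq> b"
  shows "sign (transpose a b \<circ> \<alpha> \<circ> transpose a b) = sign \<alpha>"
proof -
  have "permutation \<alpha>" using assms permutes_imp_permutation by blast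
  thus ?thesis using assms
    by (simp add: sign_compose permutation_swap_id sign_swap_id permutation_compose)
qed

text \<open>
  Swapping the values \<open>a\<close> and \<open>b\<close> of a permutation, or conjugating with the transposition, cancels all
  permutations except those that exchange \<open>a\<close> and \<open>b\<close>.
\<close>

lemma principal_minor_remove_pair:
  assumes T: "finite T" "a \<in> T" "b \<in> T" "a \<noteq> b"
    and K: "K a a = 0" "K b b = 0" "K a b = 1" "K b a = -1"
    and row: "\<And>d. d \<in> T - {a, b} \<Longrightarrow> K a d = K b d"
    and col: "\<And>d. d \<in> T - {a, b} \<Longrightarrow> K d a = K d b"
  shows "principal_minor K T = principal_minor K (T - {a, b})"
proof -
  define t where "t = transpose a b"
  define f where "f \<alpha> = sign \<alpha> * (\<Prod>d\<in>T. K (\<alpha> d) d)" for \<alpha>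
  define P where "P = {\<alpha>. \<alpha> permutes T}"
  \<comment> \<open>Permutations are sorted by the images of \<open>a\<close> and \<open>b\<close>:
    exchanged (\<open>P0\<close>), exactly one of them sent to the other (\<open>P1\<close>), both
    leaving the pair (\<open>P2\<close>), and neither sent to the other but at least one fixed
    (\<open>P3\<close>).\<close>
  define P0 where "P0 = {\<alpha>\<in>P. \<alpha> a = b \<and> \<alpha> b = a}"
  define P1 where "P1 = {\<alpha>\<in>P. (\<alpha> a = b) \<noteq> (\<alpha> b = a)}"
  define P2 where "P2 = {\<alpha>\<in>P. \<alpha> a \<notin> {a, b} \<and> \<alpha> b \<notin> {a, b}}"
  define P3 where "P3 = {\<alpha>\<in>P. \<alpha> a \<noteq> b \<and> \<alpha> b \<noteq> a \<and> (\<alpha> a = a \<or> \<alpha> b = b)}"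
  have t: "t a = b" "t b = a" "t (t x) = x" "x \<notin> {a, b} \<Longrightarrow> t x = x" for x
    by (auto simp: t_def transpose_def)
  have tT: "t permutes T" unfolding t_def using T permutes_swap_id by metis
  have finP: "finite P" unfolding P_def using T finite_permutations by blast
  have sub: "P0 \<subseteq> P" "P1 \<subseteq> P" "P2 \<subseteq> P" "P3 \<subseteq> P" by (auto simp: P0_def P1_def P2_def P3_def)
  note fin = sub[THEN finite_subset, OF finP]
  have inj: "\<alpha> x = \<alpha> y \<longleftrightarrow> x = y" if "\<alpha> \<in> P" for \<alpha> x y
    using that permutes_inj[of \<alpha> T] by (auto simp: P_def inj_eq)
  have mem: "\<alpha> x \<in> T" if "\<alpha> \<in> P" "x \<in> T" for \<alpha> x
    using that permutes_in_image by (fastforce simp: P_def)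
  have split: "P = P0 \<union> (P1 \<union> (P2 \<union> P3))" "P0 \<inter> (P1 \<union> (P2 \<union> P3)) = {}"
    "P1 \<inter> (P2 \<union> P3) = {}" "P2 \<inter> P3 = {}"
    using T inj by (auto simp: P0_def P1_def P2_def P3_def)
  have "sum f P = sum f P0 + (sum f P1 + (sum f P2 + sum f P3))"
    unfolding split(1) using split(2-) fin by (simp add: sum.union_disjoint)
  moreover have "sum f P3 = 0"
  proof (rule sum.neutral, rule ballI)
    fix \<alpha> assume "\<alpha> \<in> P3"
    \<comment> \<open>A fixed \<open>a\<close> or \<open>b\<close> picks up a zero of the
      diagonal.\<close>
    hence "\<exists>d\<in>T. K (\<alpha> d) d = 0" using T K by (auto simp: P3_def intro: bexI[of _ a] bexI[of _ b])
    thus "f \<alpha> = 0" unfolding f_def using T by (simp add: prod_zero_iff)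
  qed
  \<comment> \<open>Columns \<open>a\<close> and \<open>b\<close> meet neither row \<open>a\<close>
    nor row \<open>b\<close> here, so exchanging these rows by \<open>t\<close> keeps all entries
    while the sign flips.\<close>
  moreover have "sum f P2 = 0"
  proof (rule sum_eq_0_by_involution[where g = "\<lambda>\<alpha>. t \<circ> \<alpha>"])
    fix \<alpha> assume \<alpha>: "\<alpha> \<in> P2"
    show "t \<circ> \<alpha> \<in> P2" using \<alpha> tT t permutes_compose[of \<alpha> T t]
      by (auto simp: P2_def P_def)
    show "t \<circ> (t \<circ> \<alpha>) = \<alpha>" by (simp add: fun_eq_iff t)
    have "K ((t \<circ> \<alpha>) d) d = K (\<alpha> d) d" if "d \<in> T" for d
    proof (cases "\<alpha> d \<in> {a, b}")
      case True
      hence "d \<notin> {a, b}" using \<alpha> by (auto simp: P2_def)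
      thus ?thesis using True that row[of d] t by auto
    qed (use t in auto)
    hence "(\<Prod>d\<in>T. K ((t \<circ> \<alpha>) d) d) = (\<Prod>d\<in>T. K (\<alpha> d) d)" by simp
    moreover have "sign (t \<circ> \<alpha>) = - sign \<alpha>"
      unfolding t_def by (rule sign_transpose_comp[of T]) (use \<alpha> T in \<open>auto simp: P2_def P_def\<close>)
    ultimately show "f (t \<circ> \<alpha>) = - f \<alpha>" by (simp add: f_def del: o_apply)
  qed
  \<comment> \<open>Conjugation keeps the sign of the permutation. Exactly one entry changes, from
    \<open>K a b\<close> to \<open>K b a\<close> or back, which negates the product.\<close>
  moreover have "sum f P1 = 0"
  proof (rule sum_eq_0_by_involution[where g = "\<lambda>\<alpha>. t \<circ> \<alpha> \<circ> t"])
    fix \<alpha> assume \<alpha>: "\<alpha> \<in> P1"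
    hence \<alpha>P: "\<alpha> \<in> P" by (simp add: P1_def)
    have perm: "t \<circ> \<alpha> \<circ> t permutes T"
      using \<alpha>P tT by (auto simp: P_def intro!: permutes_compose)
    have "t (\<alpha> b) = b \<longleftrightarrow> \<alpha> b = a" "t (\<alpha> a) = a \<longleftrightarrow> \<alpha> a = b" using t by metis+
    thus "t \<circ> \<alpha> \<circ> t \<in> P1" using \<alpha> perm by (auto simp: P1_def P_def t)
    show "t \<circ> (t \<circ> \<alpha> \<circ> t) \<circ> t = \<alpha>" by (simp add: fun_eq_iff t)
    have "(\<Prod>d\<in>T. K ((t \<circ> \<alpha> \<circ> t) d) d) = (\<Prod>d\<in>T. K (t (\<alpha> d)) (t d))"
      by (rule prod.reindex_bij_witness[where i = t and j = t])
        (use tT in \<open>auto simp: t permutes_in_image\<close>)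
    also have "\<dots> = - (\<Prod>d\<in>T. K (\<alpha> d) d)"
    proof -
      obtain u where u: "u \<in> T" "K (t (\<alpha> u)) (t u) = - K (\<alpha> u) u"
        and v: "\<And>d. d \<in> T \<Longrightarrow> d \<noteq> u \<Longrightarrow> K (t (\<alpha> d)) (t d) = K (\<alpha> d) d"
      proof -
        consider "\<alpha> a = b" "\<alpha> b \<noteq> a" | "\<alpha> b = a" "\<alpha> a \<noteq> b" using \<alpha> by (auto simp: P1_def)
        thus ?thesis
        proof cases
          case 1
          hence "\<alpha> b \<noteq> b" using inj[OF \<alpha>P, of a b] T by auto
          have "K (t (\<alpha> d)) (t d) = K (\<alpha> d) d" if d: "d \<in> T" "d \<noteq> a" for d
          proof (cases "d = b")
            case True
            thus ?thesis using 1 \<open>\<alpha> b \<noteq> b\<close> t mem[OF \<alpha>P, of b] col[of "\<alpha> b"] T by auto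
          next
            case False
            have "\<alpha> d \<noteq> b" using inj[OF \<alpha>P, of a d] 1 d by auto
            thus ?thesis using False d t row[of d] by (cases "\<alpha> d = a") auto
          qed
          thus ?thesis using that[of a] 1 T K t by auto
        next
          case 2
          hence "\<alpha> a \<noteq> a" using inj[OF \<alpha>P, of a b] T by auto
          have "K (t (\<alpha> d)) (t d) = K (\<alpha> d) d" if d: "d \<in> T" "d \<noteq> b" for d
          proof (cases "d = a")
            case True
            thus ?thesis using 2 \<open>\<alpha> a \<noteq> a\<close> t mem[OF \<alpha>P, of a] col[of "\<alpha> a"] T by auto
          next
            case False
            have "\<alpha> d \<noteq> a" using inj[OF \<alpha>P, of b d] 2 d by auto
            thus ?thesis using False d t row[of d] by (cases "\<alpha> d = b") auto
          qed
          thus ?thesis using that[of b] 2 T K t by auto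
        qed
      qed
      have "(\<Prod>d\<in>T - {u}. K (t (\<alpha> d)) (t d)) = (\<Prod>d\<in>T - {u}. K (\<alpha> d) d)"
        by (rule prod.cong) (use v in auto)
      thus ?thesis using u T by (simp add: prod.remove[of T u])
    qed
    finally have "(\<Prod>d\<in>T. K ((t \<circ> \<alpha> \<circ> t) d) d) = - (\<Prod>d\<in>T. K (\<alpha> d) d)" .
    moreover have "sign (t \<circ> \<alpha> \<circ> t) = sign \<alpha>"
      unfolding t_def by (rule sign_transpose_conj[of T]) (use \<alpha>P T in \<open>auto simp: P_def\<close>)
    ultimately show "f (t \<circ> \<alpha> \<circ> t) = - f \<alpha>" by (simp add: f_def del: o_apply)
  qed
  \<comment> \<open>The entries \<open>K b a\<close> and \<open>K a b\<close> multiply to -1, which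
    offsets the sign of the removed transposition.\<close>
  moreover have "sum f P0 = principal_minor K (T - {a, b})"
    unfolding principal_minor_def
  proof (rule sum.reindex_bij_witness[where i = "\<lambda>\<alpha>. t \<circ> \<alpha>" and j = "\<lambda>\<alpha>. t \<circ> \<alpha>"])
    fix \<alpha> assume \<alpha>: "\<alpha> \<in> P0"
    show "t \<circ> (t \<circ> \<alpha>) = \<alpha>" by (simp add: fun_eq_iff t)
    have \<alpha>': "\<alpha> permutes T" "\<alpha> a = b" "\<alpha> b = a" using \<alpha> by (auto simp: P0_def P_def)
    have "t \<circ> \<alpha> permutes T" using \<alpha>'(1) tT by (rule permutes_compose)
    moreover have "(t \<circ> \<alpha>) x = x" if "x \<in> T - (T - {a, b})" for x
    proof -
      have "x = a \<or> x = b" using that by blast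
      thus ?thesis using \<alpha>'(2,3) t(1,2) by auto
    qed
    ultimately have "t \<circ> \<alpha> permutes T - {a, b}" by (rule permutes_superset)
    thus "t \<circ> \<alpha> \<in> {\<alpha>. \<alpha> permutes T - {a, b}}" by simp
    have "(\<Prod>d\<in>T - {a, b}. K ((t \<circ> \<alpha>) d) d) = (\<Prod>d\<in>T - {a, b}. K (\<alpha> d) d)"
    proof (rule prod.cong)
      fix d assume d: "d \<in> T - {a, b}"
      have "\<alpha> \<in> P" "\<alpha> a = b" "\<alpha> b = a" using \<alpha> by (auto simp: P0_def)
      hence "\<alpha> d \<notin> {a, b}" using d inj[of \<alpha> d a] inj[of \<alpha> d b] by auto
      thus "K ((t \<circ> \<alpha>) d) d = K (\<alpha> d) d" by (simp add: t)
    qed simp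
    moreover have "(\<Prod>d\<in>T. K (\<alpha> d) d) = - (\<Prod>d\<in>T - {a, b}. K (\<alpha> d) d)"
    proof -
      have "T - {a} - {b} = T - {a, b}" by auto
      thus ?thesis using \<alpha> T K
        by (simp add: prod.remove[of T a] prod.remove[of "T - {a}" b] P0_def)
    qed
    moreover have "sign (t \<circ> \<alpha>) = - sign \<alpha>"
      unfolding t_def by (rule sign_transpose_comp[of T]) (use \<alpha> T in \<open>auto simp: P0_def P_def\<close>)
    ultimately show "sign (t \<circ> \<alpha>) * (\<Prod>d\<in>T - {a, b}. K ((t \<circ> \<alpha>) d) d) = f \<alpha>"
      by (simp add: f_def del: o_apply)
  next
    fix \<alpha> assume \<alpha>: "\<alpha> \<in> {\<alpha>. \<alpha> permutes T - {a, b}}"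
    show "t \<circ> (t \<circ> \<alpha>) = \<alpha>" by (simp add: fun_eq_iff t)
    have "\<alpha> permutes T" using \<alpha> permutes_subset by blast
    hence "t \<circ> \<alpha> permutes T" using tT permutes_compose by blast
    moreover have "\<alpha> a = a" "\<alpha> b = b" using \<alpha> by (auto simp: permutes_def)
    ultimately show "t \<circ> \<alpha> \<in> P0" by (auto simp: P0_def P_def t)
  qed
  ultimately show ?thesis by (simp add: principal_minor_def f_def P_def)
qed

definition block_tournament :: "('v :: linorder \<Rightarrow> 'b) \<Rightarrow> 'v \<Rightarrow> 'v \<Rightarrow> int" where
  "block_tournament \<beta> u v =
     (if \<beta> u = \<beta> v then if u < v then 1 else if v < u then - 1 else 0 else 0)"

text \<open>The two smallest vertices of a block have equal rows and columns outside the pair, so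
  they can be removed without changing the minor or any parity. Once no block has two vertices, the
  matrix on \<open>T\<close> is zero, and its minor is 1 only for empty \<open>T\<close>.\<close>

lemma principal_minor_block_tournament:
  fixes \<beta> :: "'v :: linorder \<Rightarrow> 'b"
  assumes "finite T"
  shows "principal_minor (block_tournament \<beta>) T = of_bool (\<forall>c. even (card {v\<in>T. \<beta> v = c}))"
  using assms
proof (induction "card T" arbitrary: T rule: less_induct)
  case less
  show ?case
  proof (cases "\<exists>u\<in>T. \<exists>v\<in>T. u < v \<and> \<beta> u = \<beta> v")
    case True
    then obtain u v where uv: "u \<in> T" "v \<in> T" "u < v" "\<beta> u = \<beta> v" by auto
    \<comment> \<open>A pair such as \<open>u\<close>, \<open>v\<close> may disagree at block
      members lying between them; the two least members have none in between.\<close>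
    define S where "S = {x\<in>T. \<beta> x = \<beta> u}"
    define a where "a = Min S"
    define b where "b = Min (S - {a})"
    have S: "finite S" "u \<in> S" "v \<in> S" using less.prems uv by (auto simp: S_def)
    have aS: "a \<in> S" unfolding a_def using S by (intro Min_in) auto
    have "S - {a} \<noteq> {}" using S uv by auto
    hence bS: "b \<in> S - {a}" unfolding b_def using S by (intro Min_in) auto
    have a_le: "a \<le> x" if "x \<in> S" for x unfolding a_def using S that by auto
    have b_le: "b \<le> x" if "x \<in> S - {a}" for x unfolding b_def using S that by (intro Min_le) auto
    have ab: "a \<in> T" "b \<in> T" "a < b" "\<beta> a = \<beta> u" "\<beta> b = \<beta> u"
      using aS bS a_le[of b] by (auto simp: S_def)
    have ge: "a < d \<and> b < d" if "d \<in> T - {a, b}" "\<beta> d = \<beta> u" for d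
      using that a_le[of d] b_le[of d] by (auto simp: S_def order.strict_iff_order)
    have "principal_minor (block_tournament \<beta>) T = principal_minor (block_tournament \<beta>) (T - {a, b})"
    proof (rule principal_minor_remove_pair)
      fix d assume d: "d \<in> T - {a, b}"
      show "block_tournament \<beta> a d = block_tournament \<beta> b d"
        "block_tournament \<beta> d a = block_tournament \<beta> d b"
        using d ge[of d] ab by (auto simp: block_tournament_def)
    qed (use ab less.prems in \<open>auto simp: block_tournament_def\<close>)
    also have "\<dots> = of_bool (\<forall>c. even (card {v\<in>T - {a, b}. \<beta> v = c}))"
      using less.prems ab by (intro less.hyps psubset_card_mono) auto
    also have "(\<forall>c. even (card {v\<in>T - {a, b}. \<beta> v = c})) \<longleftrightarrow> (\<forall>c. even (card {v\<in>T. \<beta> v = c}))"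
    proof (intro all_cong1)
      fix c
      show "even (card {v\<in>T - {a, b}. \<beta> v = c}) \<longleftrightarrow> even (card {v\<in>T. \<beta> v = c})"
      proof (cases "c = \<beta> u")
        case True
        have "{v\<in>T. \<beta> v = c} = insert a (insert b {v\<in>T - {a, b}. \<beta> v = c})"
          using ab True by auto
        thus ?thesis using less.prems ab by simp
      next
        case False
        have "{v\<in>T - {a, b}. \<beta> v = c} = {v\<in>T. \<beta> v = c}" using False ab by auto
        thus ?thesis by simp
      qed
    qed
    finally show ?thesis .
  next
    case False
    hence single: "u = v" if "u \<in> T" "v \<in> T" "\<beta> u = \<beta> v" for u v
      using that by (metis linorder_neq_iff)
    show ?thesis
    proof (cases "T = {}")
      case True
      thus ?thesis by (simp add: principal_minor_def)
    next
      case False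
      then obtain u where u: "u \<in> T" by auto
      have "{v\<in>T. \<beta> v = \<beta> u} = {u}" using u single by auto
      hence "odd (card {v\<in>T. \<beta> v = \<beta> u})" by simp
      moreover have "principal_minor (block_tournament \<beta>) T = 0"
        unfolding principal_minor_def
      proof (rule sum.neutral, safe)
        fix \<alpha> assume "\<alpha> permutes T"
        hence "\<alpha> u \<in> T" using u by (simp add: permutes_in_image)
        hence "block_tournament \<beta> (\<alpha> u) u = 0" using single[of "\<alpha> u" u] u
          by (auto simp: block_tournament_def)
        thus "sign \<alpha> * (\<Prod>d\<in>T. block_tournament \<beta> (\<alpha> d) d) = 0"
          using u less.prems by (auto simp: prod_zero_iff)
      qed
      ultimately show ?thesis by auto
    qed
  qed
qed

section \<open>Expansion of the 4-determinant\<close>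

lemma zpow_0: "zpow 0 = 1"
  by (simp add: zpow_def)

lemma zpow_add: "zpow (r + s) = zpow r * zpow s"
  by (simp add: zpow_def mult_single)

lemma zpow_sum: "zpow (sum f A) = (\<Prod>x\<in>A. zpow (f x))"
  by (induction A rule: infinite_finite_induct) (simp_all add: zpow_0 zpow_add)

text \<open>Multiply out: \<open>T\<close> collects the positions where the factor \<open>M\<close>
  is chosen. Elsewhere the identity matrix forces all three permutations to fix the point, so they
  permute \<open>T\<close>; \<open>sign\<close> depends on the function alone and needs no
  conversion.\<close>

lemma det4_identity_add:
  fixes M :: "('v, 'r :: comm_ring_1) mat4"
  assumes V: "finite V"
  shows "det4 V (\<lambda>a. identity4 a + M a) = (\<Sum>T\<in>Pow V. det4 T M)"
proof -
  define g where "g \<alpha> \<beta> \<gamma> T = of_int (sign \<alpha> * sign \<beta> * sign \<gamma>) *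
    (\<Prod>i\<in>T. M (\<alpha> i, \<beta> i, \<gamma> i, i))" for \<alpha> \<beta> \<gamma> T
  define keeps where "keeps T \<alpha> \<longleftrightarrow> (\<forall>i\<in>V - T. \<alpha> i = i)" for T \<alpha>
  have perm: "{\<alpha>. \<alpha> permutes V} \<inter> {\<alpha>. keeps T \<alpha>} = {\<alpha>. \<alpha> permutes T}" if "T \<subseteq> V" for T
    using that permutes_superset[of _ V T] permutes_subset[of _ T V]
    by (auto simp: keeps_def permutes_not_in)
  have fin: "finite {\<alpha>. \<alpha> permutes V}" using V by (rule finite_permutations)
  have "of_int (sign \<alpha> * sign \<beta> * sign \<gamma>) *
      (\<Prod>i\<in>V. identity4 (\<alpha> i, \<beta> i, \<gamma> i, i) + M (\<alpha> i, \<beta> i, \<gamma> i, i)) =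
      (\<Sum>T\<in>Pow V. if keeps T \<alpha> then if keeps T \<beta> then if keeps T \<gamma> then g \<alpha> \<beta> \<gamma> T else 0 else 0 else 0)"
    (is "?l = _") for \<alpha> \<beta> \<gamma>
  proof -
    have "?l = of_int (sign \<alpha> * sign \<beta> * sign \<gamma>) *
      (\<Prod>i\<in>V. M (\<alpha> i, \<beta> i, \<gamma> i, i) + identity4 (\<alpha> i, \<beta> i, \<gamma> i, i))"
      by (simp add: add.commute)
    also have "\<dots> = (\<Sum>T\<in>Pow V. g \<alpha> \<beta> \<gamma> T * (\<Prod>i\<in>V - T. identity4 (\<alpha> i, \<beta> i, \<gamma> i, i)))"
      using V by (simp add: prod_add sum_distrib_left g_def mult.assoc)
    also have "\<dots> = (\<Sum>T\<in>Pow V. if keeps T \<alpha> then if keeps T \<beta> then if keeps T \<gamma> then g \<alpha> \<beta> \<gamma> T else 0 else 0 else 0)"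
    proof (rule sum.cong)
      fix T
      show "g \<alpha> \<beta> \<gamma> T * (\<Prod>i\<in>V - T. identity4 (\<alpha> i, \<beta> i, \<gamma> i, i)) =
        (if keeps T \<alpha> then if keeps T \<beta> then if keeps T \<gamma> then g \<alpha> \<beta> \<gamma> T else 0 else 0 else 0)"
      proof (cases "keeps T \<alpha> \<and> keeps T \<beta> \<and> keeps T \<gamma>")
        case True
        hence "(\<Prod>i\<in>V - T. identity4 (\<alpha> i, \<beta> i, \<gamma> i, i) :: 'r) = 1"
          by (intro prod.neutral) (auto simp: keeps_def identity4_def)
        thus ?thesis using True by simp
      next
        case False
        then obtain i where "i \<in> V - T" "identity4 (\<alpha> i, \<beta> i, \<gamma> i, i) = (0 :: 'r)"
          by (auto simp: keeps_def identity4_def) metis+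
        hence "(\<Prod>i\<in>V - T. identity4 (\<alpha> i, \<beta> i, \<gamma> i, i) :: 'r) = 0"
          using V by (intro prod_zero) auto
        thus ?thesis using False by auto
      qed
    qed simp
    finally show ?thesis .
  qed
  hence "det4 V (\<lambda>a. identity4 a + M a) =
      (\<Sum>\<alpha> | \<alpha> permutes V. \<Sum>\<beta> | \<beta> permutes V. \<Sum>\<gamma> | \<gamma> permutes V. \<Sum>T\<in>Pow V.
        if keeps T \<alpha> then if keeps T \<beta> then if keeps T \<gamma> then g \<alpha> \<beta> \<gamma> T else 0 else 0 else 0)"
    by (simp add: det4_def)
  also have "\<dots> = (\<Sum>T\<in>Pow V. \<Sum>\<alpha> | \<alpha> permutes V. \<Sum>\<beta> | \<beta> permutes V. \<Sum>\<gamma> | \<gamma> permutes V.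
        if keeps T \<alpha> then if keeps T \<beta> then if keeps T \<gamma> then g \<alpha> \<beta> \<gamma> T else 0 else 0 else 0)"
    by (simp only: sum.swap[of _ "Pow V"])
  also have "\<dots> = (\<Sum>T\<in>Pow V. det4 T M)"
  proof (rule sum.cong)
    fix T assume "T \<in> Pow V"
    hence T: "T \<subseteq> V" by simp
    have restrict: "(\<Sum>\<alpha> | \<alpha> permutes V. if keeps T \<alpha> then h \<alpha> else 0) = (\<Sum>\<alpha> | \<alpha> permutes T. h \<alpha>)"
      for h :: "('v \<Rightarrow> 'v) \<Rightarrow> 'r"
      unfolding perm[OF T, symmetric] sum.inter_restrict[OF fin] by simp
    have "(\<Sum>\<beta> | \<beta> permutes V. \<Sum>\<gamma> | \<gamma> permutes V.
        if keeps T \<alpha> then if keeps T \<beta> then if keeps T \<gamma> then g \<alpha> \<beta> \<gamma> T else 0 else 0 else 0) =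
        (if keeps T \<alpha> then \<Sum>\<beta> | \<beta> permutes V. if keeps T \<beta> then
          \<Sum>\<gamma> | \<gamma> permutes V. if keeps T \<gamma> then g \<alpha> \<beta> \<gamma> T else 0 else 0 else 0)" for \<alpha>
      by (auto intro!: sum.cong sum.neutral)
    thus "(\<Sum>\<alpha> | \<alpha> permutes V. \<Sum>\<beta> | \<beta> permutes V. \<Sum>\<gamma> | \<gamma> permutes V.
        if keeps T \<alpha> then if keeps T \<beta> then if keeps T \<gamma> then g \<alpha> \<beta> \<gamma> T else 0 else 0 else 0) = det4 T M"
      by (simp add: restrict g_def det4_def)
  qed simp
  finally show ?thesis .
qed

text \<open>
  The second and the third coordinate force the permutations \<open>\<tau>\<close> and its inverse of \<open>T\<close>, whose signs cancel.
\<close>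

lemma det4_two_permutations:
  fixes M :: "('v, gpoly) mat4"
  assumes T: "finite T" and \<tau>: "inj_on \<tau> T"
    and M: "\<And>a b c d. a \<in> T \<Longrightarrow> c \<in> T \<Longrightarrow> d \<in> T \<Longrightarrow>
      M (a, b, c, d) = (if b = \<tau> d \<and> d = \<tau> c then of_int (K a d) * zpow (wt d) else 0)"
  shows "det4 T M = (if \<tau> ` T = T then of_int (principal_minor K T) * zpow (sum wt T) else 0)"
proof -
  define S where "S \<alpha> \<beta> = (\<Sum>\<gamma> | \<gamma> permutes T. of_int (sign \<alpha> * sign \<beta> * sign \<gamma>) *
        (\<Prod>i\<in>T. M (\<alpha> i, \<beta> i, \<gamma> i, i)))" for \<alpha> \<beta>
  have det: "det4 T M = (\<Sum>\<alpha> | \<alpha> permutes T. \<Sum>\<beta> | \<beta> permutes T. S \<alpha> \<beta>)"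
    by (simp add: det4_def S_def)
  have fin: "finite {\<alpha>. \<alpha> permutes T}" using T by (rule finite_permutations)
  \<comment> \<open>\<open>\<tau>\<close> is arbitrary outside \<open>T\<close>, whereas a function
    that permutes \<open>T\<close> is the identity there.\<close>
  define \<sigma> where "\<sigma> = restrict_id \<tau> T"
  \<comment> \<open>Nonzero factors at every \<open>i\<close> give
    \<open>\<beta> i = \<tau> i\<close> and \<open>\<tau> (\<gamma> i) = i\<close>; this forces
    invariance of \<open>T\<close> and leaves one choice for each of \<open>\<beta>\<close> and
    \<open>\<gamma>\<close>.\<close>
  have nz: "\<tau> ` T = T \<and> \<beta> = \<sigma> \<and> \<gamma> = inv_into UNIV \<sigma>"
    if "\<alpha> permutes T" "\<beta> permutes T" "\<gamma> permutes T" "(\<Prod>i\<in>T. M (\<alpha> i, \<beta> i, \<gamma> i, i)) \<noteq> 0" for \<alpha> \<beta> \<gamma>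
  proof -
    have *: "M (\<alpha> i, \<beta> i, \<gamma> i, i) \<noteq> 0" if "i \<in> T" for i
      using \<open>(\<Prod>i\<in>T. M (\<alpha> i, \<beta> i, \<gamma> i, i)) \<noteq> 0\<close> prod_zero[OF T, of "\<lambda>i. M (\<alpha> i, \<beta> i, \<gamma> i, i)"] that by auto
    have **: "\<beta> i = \<tau> i" "i = \<tau> (\<gamma> i)" if "i \<in> T" for i
      using *[OF that] that \<open>\<alpha> permutes T\<close> \<open>\<gamma> permutes T\<close>
      by (auto simp: M permutes_in_image split: if_splits)
    have "\<tau> ` T = \<beta> ` T" using ** by force
    hence im: "\<tau> ` T = T" using \<open>\<beta> permutes T\<close> permutes_image by metis
    have "\<beta> x = \<sigma> x" for x
      using **(1) permutes_not_in[OF \<open>\<beta> permutes T\<close>, of x] by (cases "x \<in> T") (auto simp: \<sigma>_def)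
    hence \<beta>: "\<beta> = \<sigma>" by auto
    have "\<sigma> (\<gamma> x) = x" for x
      using **(2)[of x] that(3) permutes_not_in[OF that(3), of x] permutes_in_image[OF that(3), of x]
      by (cases "x \<in> T") (auto simp: \<sigma>_def)
    hence "\<gamma> = inv_into UNIV \<sigma>" using \<beta> permutes_inverses(2)[OF that(2)] by (metis ext)
    thus ?thesis using im \<beta> by simp
  qed
  show ?thesis
  proof (cases "\<tau> ` T = T")
    case False
    hence "S \<alpha> \<beta> = 0" if "\<alpha> permutes T" "\<beta> permutes T" for \<alpha> \<beta>
      unfolding S_def using nz that by (intro sum.neutral) force
    thus ?thesis using False by (simp add: det)
  next
    case True
    hence \<sigma>: "\<sigma> permutes T"
      unfolding \<sigma>_def using \<tau> by (intro permutes_restrict_id) (auto simp: bij_betw_def)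
    hence inv\<sigma>: "inv_into UNIV \<sigma> permutes T" by (rule permutes_inv)
    have "\<tau> (inv_into UNIV \<sigma> i) = i" if "i \<in> T" for i
      using permutes_inverses(1)[OF \<sigma>, of i] that permutes_in_image[OF inv\<sigma>, of i] by (simp add: \<sigma>_def)
    hence entry: "M (\<alpha> i, \<sigma> i, inv_into UNIV \<sigma> i, i) = of_int (K (\<alpha> i) i) * zpow (wt i)"
      if "\<alpha> permutes T" "i \<in> T" for \<alpha> i
      using that inv\<sigma> by (simp add: M permutes_in_image \<sigma>_def)
    have "(\<Sum>\<beta> | \<beta> permutes T. S \<alpha> \<beta>) =
        of_int (sign \<alpha> * (\<Prod>i\<in>T. K (\<alpha> i) i)) * zpow (sum wt T)" if "\<alpha> permutes T" for \<alpha>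
    proof -
      have "S \<alpha> \<beta> = 0" if "\<beta> permutes T" "\<beta> \<noteq> \<sigma>" for \<beta>
        unfolding S_def using nz that \<open>\<alpha> permutes T\<close> by (intro sum.neutral) force
      hence "(\<Sum>\<beta> | \<beta> permutes T. S \<alpha> \<beta>) = (\<Sum>\<beta>\<in>{\<sigma>}. S \<alpha> \<beta>)"
        using fin \<sigma> by (intro sum.mono_neutral_right) auto
      also have "\<dots> = S \<alpha> \<sigma>" by simp
      also have "\<dots> = (\<Sum>\<gamma>\<in>{inv_into UNIV \<sigma>}. of_int (sign \<alpha> * sign \<sigma> * sign \<gamma>) *
        (\<Prod>i\<in>T. M (\<alpha> i, \<sigma> i, \<gamma> i, i)))"
        unfolding S_def using fin inv\<sigma> nz[OF \<open>\<alpha> permutes T\<close> \<sigma>]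
        by (intro sum.mono_neutral_right) force+
      also have "\<dots> = of_int (sign \<alpha>) * (\<Prod>i\<in>T. M (\<alpha> i, \<sigma> i, inv_into UNIV \<sigma> i, i))"
        using permutes_imp_permutation[OF T \<sigma>] by (simp add: sign_inverse mult.assoc flip: of_int_mult)
      also have "\<dots> = of_int (sign \<alpha> * (\<Prod>i\<in>T. K (\<alpha> i) i)) * zpow (sum wt T)"
        using that by (simp add: entry prod.distrib zpow_sum of_int_prod)
      finally show ?thesis .
    qed
    thus ?thesis using True
      by (simp add: det principal_minor_def sum_distrib_right of_int_sum)
  qed
qed

section \<open>The hypergraph\<close>

text \<open>An arc is determined by \<open>a\<close> and \<open>c\<close>; the other two lie in
  \<open>V\<close> as soon as \<open>\<tau>\<close> maps \<open>V\<close> into itself. The condition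
  \<open>a \<noteq> d\<close> leaves out the zero diagonal of the tournament matrix.\<close>

definition block_arcs :: "'v set \<Rightarrow> ('v \<Rightarrow> 'v) \<Rightarrow> ('v \<Rightarrow> 'b) \<Rightarrow> 'v arc set" where
  "block_arcs V \<tau> \<beta> =
     {(a, b, c, d). a \<in> V \<and> c \<in> V \<and> b = \<tau> d \<and> d = \<tau> c \<and> \<beta> a = \<beta> d \<and> a \<noteq> d}"

definition signed_block_arcs ::
  "'v :: linorder set \<Rightarrow> ('v \<Rightarrow> 'v) \<Rightarrow> ('v \<Rightarrow> 'b) \<Rightarrow> ('v \<Rightarrow> real) \<Rightarrow> ('v, gpoly) mat4" where
  "signed_block_arcs V \<tau> \<beta> wt = (\<lambda>(a, b, c, d). if (a, b, c, d) \<in> block_arcs V \<tau> \<beta>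
     then of_int (block_tournament \<beta> a d) * zpow (wt d) else 0)"

lemma mem_block_arcs:
  "(a, b, c, d) \<in> block_arcs V \<tau> \<beta> \<longleftrightarrow>
     a \<in> V \<and> c \<in> V \<and> b = \<tau> d \<and> d = \<tau> c \<and> \<beta> a = \<beta> d \<and> a \<noteq> d"
  by (simp add: block_arcs_def)

text \<open>Being neighbours of \<open>d\<close> under \<open>\<tau>\<close>, both \<open>b\<close>
  and \<open>c\<close> lie outside the block shared by \<open>a\<close> and \<open>d\<close>, which
  separates four pairs; \<open>b \<noteq> c\<close> is the absence of points of period two.\<close>

lemma directed_4hypergraph_block_arcs:
  assumes "finite V" "\<tau> ` V \<subseteq> V"
    and "\<And>v. v \<in> V \<Longrightarrow> \<tau> (\<tau> v) \<noteq> v" "\<And>v. v \<in> V \<Longrightarrow> \<beta> (\<tau> v) \<noteq> \<beta> v"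
  shows "directed_4hypergraph V (block_arcs V \<tau> \<beta>)"
proof -
  have "{a, b, c, d} \<subseteq> V \<and> distinct [a, b, c, d]" if "(a, b, c, d) \<in> block_arcs V \<tau> \<beta>" for a b c d
  proof -
    have *: "a \<in> V" "c \<in> V" "b = \<tau> d" "d = \<tau> c" "\<beta> a = \<beta> d" "a \<noteq> d"
      using that by (auto simp: mem_block_arcs)
    hence "d \<in> V" "b \<in> V" using assms(2) by auto
    thus ?thesis using * assms(3)[of c] assms(4)[of c] assms(4)[of d] by auto
  qed
  thus ?thesis using assms(1) by (auto simp: directed_4hypergraph_def)
qed

lemma is_signing_signed_block_arcs:
  fixes V :: "'v :: linorder set"
  assumes "\<And>a b c d. (a, b, c, d) \<in> block_arcs V \<tau> \<beta> \<Longrightarrow> t (a, b, c, d) = wt d"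
  shows "is_signing (signed_block_arcs V \<tau> \<beta> wt) (adjacency4 (block_arcs V \<tau> \<beta>) t)"
  unfolding is_signing_def
proof
  fix x :: "'v arc"
  obtain a b c d where x: "x = (a, b, c, d)" by (metis prod_cases4)
  have "block_tournament \<beta> a d = 1 \<or> block_tournament \<beta> a d = - 1"
    if "(a, b, c, d) \<in> block_arcs V \<tau> \<beta>"
    using that unfolding mem_block_arcs block_tournament_def by auto
  thus "signed_block_arcs V \<tau> \<beta> wt x = adjacency4 (block_arcs V \<tau> \<beta>) t x \<or>
      signed_block_arcs V \<tau> \<beta> wt x = - adjacency4 (block_arcs V \<tau> \<beta>) t x"
    using assms[of a b c d] unfolding x signed_block_arcs_def adjacency4_def by auto
qed

text \<open>The minor of the block tournament is 0 or 1, so each surviving set enters without a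
  sign.\<close>

lemma det4_signed_block_arcs:
  assumes V: "finite V" and \<tau>: "inj_on \<tau> V"
  shows "det4 V (\<lambda>a. identity4 a + signed_block_arcs V \<tau> \<beta> wt a) =
    (\<Sum>T | T \<subseteq> V \<and> \<tau> ` T = T \<and> (\<forall>c. even (card {v\<in>T. \<beta> v = c})). zpow (sum wt T))"
proof -
  have "det4 T (signed_block_arcs V \<tau> \<beta> wt) =
      (if \<tau> ` T = T \<and> (\<forall>c. even (card {v\<in>T. \<beta> v = c})) then zpow (sum wt T) else 0)"
    if T: "T \<subseteq> V" for T
  proof -
    have fin: "finite T" using T V by (rule finite_subset)
    have "det4 T (signed_block_arcs V \<tau> \<beta> wt) = (if \<tau> ` T = T
        then of_int (principal_minor (block_tournament \<beta>) T) * zpow (sum wt T) else 0)"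
    proof (rule det4_two_permutations[OF fin inj_on_subset[OF \<tau> T]])
      fix a b c d assume "a \<in> T" "c \<in> T" "d \<in> T"
      thus "signed_block_arcs V \<tau> \<beta> wt (a, b, c, d) = (if b = \<tau> d \<and> d = \<tau> c
          then of_int (block_tournament \<beta> a d) * zpow (wt d) else 0)"
        using T by (auto simp: signed_block_arcs_def mem_block_arcs block_tournament_def)
    qed
    thus ?thesis using fin by (simp add: principal_minor_block_tournament)
  qed
  hence "det4 V (\<lambda>a. identity4 a + signed_block_arcs V \<tau> \<beta> wt a) =
      (\<Sum>T\<in>Pow V. if \<tau> ` T = T \<and> (\<forall>c. even (card {v\<in>T. \<beta> v = c})) then zpow (sum wt T) else 0)"
    using V by (simp add: det4_identity_add)
  also have "\<dots> = (\<Sum>T | T \<in> Pow V \<and> \<tau> ` T = T \<and> (\<forall>c. even (card {v\<in>T. \<beta> v = c})). zpow (sum wt T))"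
    by (rule sum.inter_filter[symmetric]) (use V in simp)
  finally show ?thesis by simp
qed

text \<open>
  Vertex \<open>r * (4 * n) + 4 * j + s\<close> with \<open>r \<le> k\<close>, \<open>j < n\<close>, \<open>s < 4\<close> is the \<open>s\<close>-th copy of coordinate \<open>j\<close> of
  the codeword if \<open>r = 0\<close>, and the \<open>s\<close>-th copy of the bit that says whether row \<open>r - 1\<close> of the generator
  matrix is used, reserved for coordinate \<open>j\<close>, if \<open>r > 0\<close>. The permutation has one cycle for each
  coordinate and one for each row; four copies make all cycles long enough for arcs to have
  distinct vertices. The blocks with number below \<open>4 * n\<close> are the parity checks. A vertex that takes
  part in no check is paired with its second next copy, so that its block is even anyway.
\<close>

definition row_successor :: "nat \<Rightarrow> nat \<Rightarrow> nat" where
  "row_successor n v = (if v < 4 * n then if v mod 4 = 3 then v - 3 else v + 1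
     else if v mod (4 * n) = 4 * n - 1 then v - (4 * n - 1) else v + 1)"

definition column_block :: "nat \<Rightarrow> bit mat \<Rightarrow> nat \<Rightarrow> nat" where
  "column_block n G v =
     (if v < 4 * n \<or> G $$ (v div (4 * n) - 1, v mod (4 * n) div 4) = 1 then v mod (4 * n)
      else if v mod 4 < 2 then v else v - 2)"

text \<open>An invariant set contains all four copies of a coordinate or none, so a single copy
  carries the whole weight.\<close>

definition vertex_weight :: "nat \<Rightarrow> (nat \<Rightarrow> real) \<Rightarrow> nat \<Rightarrow> real" where
  "vertex_weight n w v = (if v < 4 * n \<and> v mod 4 = 0 then w (v div 4) else 0)"

text \<open>The support of the sum, over the two-element field, of the rows in
  \<open>X\<close>.\<close>

definition parity_support :: "nat \<Rightarrow> bit mat \<Rightarrow> nat set \<Rightarrow> nat set" where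
  "parity_support n G X = {j. j < n \<and> odd (card {i\<in>X. G $$ (i, j) = 1})}"

section \<open>Arithmetic of vertex numbers, cycles and blocks\<close>

lemma vertex_div_mod:
  fixes p :: nat
  assumes "p < 4 * n"
  shows "(r * (4 * n) + p) div (4 * n) = r" "(r * (4 * n) + p) mod (4 * n) = p"
    "(r * (4 * n) + p) mod 4 = p mod 4" "r * (4 * n) + p < 4 * n \<longleftrightarrow> r = 0"
proof -
  show "(r * (4 * n) + p) div (4 * n) = r" "(r * (4 * n) + p) mod (4 * n) = p"
    using assms by auto
  have "r * (4 * n) + p = p + 4 * (r * n)" by simp
  thus "(r * (4 * n) + p) mod 4 = p mod 4" by (metis mod_mult_self2)
  show "r * (4 * n) + p < 4 * n \<longleftrightarrow> r = 0" using assms by (cases r) auto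
qed

lemma vertexE:
  fixes v :: nat
  assumes "v < 4 * n * (k + 1)"
  obtains r p where "v = r * (4 * n) + p" "r \<le> k" "p < 4 * n"
proof
  show "v = v div (4 * n) * (4 * n) + v mod (4 * n)" by (rule div_mult_mod_eq[symmetric])
  have "0 < 4 * n" using assms by (cases n) auto
  thus "v mod (4 * n) < 4 * n" by simp
  show "v div (4 * n) \<le> k"
    using assms by (simp add: less_mult_imp_div_less mult.commute flip: less_Suc_eq_le)
qed

lemma vertex_less:
  fixes p :: nat
  assumes "r \<le> k" "p < 4 * n"
  shows "r * (4 * n) + p < 4 * n * (k + 1)"
proof -
  have "r * (4 * n) \<le> k * (4 * n)" using assms by simp
  moreover have "4 * n * (k + 1) = k * (4 * n) + 4 * n" by (simp add: algebra_simps)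
  ultimately show ?thesis using assms by linarith
qed

lemma vertex_eq_iff:
  fixes p :: nat
  assumes "p < 4 * n" "q < 4 * n"
  shows "r * (4 * n) + p = r' * (4 * n) + q \<longleftrightarrow> r = r' \<and> p = q"
  using vertex_div_mod[OF assms(1), of r] vertex_div_mod[OF assms(2), of r'] by metis

lemma row_successor_vertex:
  assumes "p < 4 * n"
  shows "row_successor n (r * (4 * n) + p) = r * (4 * n) +
    (if r = 0 then if p mod 4 = 3 then p - 3 else p + 1 else if p = 4 * n - 1 then 0 else p + 1)"
  using assms by (auto simp: row_successor_def vertex_div_mod)

lemma column_block_vertex:
  assumes "p < 4 * n"
  shows "column_block n G (r * (4 * n) + p) =
    (if r = 0 \<or> G $$ (r - 1, p div 4) = 1 then p
     else if p mod 4 < 2 then r * (4 * n) + p else r * (4 * n) + p - 2)"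
  using assms by (auto simp: column_block_def vertex_div_mod)

lemma row_successor_position:
  assumes "p < 4 * n"
  obtains q where "q < 4 * n" "row_successor n (r * (4 * n) + p) = r * (4 * n) + q"
    "q = (if r = 0 then if p mod 4 = 3 then p - 3 else p + 1 else if p = 4 * n - 1 then 0 else p + 1)"
proof
  show "(if r = 0 then if p mod 4 = 3 then p - 3 else p + 1 else if p = 4 * n - 1 then 0 else p + 1) < 4 * n"
    using assms by (cases "r = 0"; simp; (presburger)?)
qed (rule row_successor_vertex[OF assms], simp)

lemma nat_mod_4_cases:
  fixes p :: nat
  obtains j where "p = 4 * j" | j where "p = 4 * j + 1" | j where "p = 4 * j + 2" | j where "p = 4 * j + 3"
proof -
  have "p mod 4 = 0 \<or> p mod 4 = 1 \<or> p mod 4 = 2 \<or> p mod 4 = 3" by linarith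
  moreover have "p = 4 * (p div 4) + p mod 4" by simp
  ultimately show ?thesis using that[of "p div 4"] by (metis add_0_right)
qed

lemma div_mod_4_simps:
  "Suc (4 * j) div 4 = j" "Suc (Suc (4 * j)) div 4 = j" "(4 * j + 3) div 4 = j"
  "Suc (4 * j) mod 4 = 1" "Suc (Suc (4 * j)) mod 4 = 2" "(4 * j + 3) mod 4 = 3"
  by presburger+

text \<open>For the cycles of the coordinates: excluding period one puts neighbours into different
  checks, excluding period two keeps the second and third vertex of an arc apart.\<close>

lemma successor_mod_4_twice:
  fixes p :: nat
  assumes "q = (if p mod 4 = 3 then p - 3 else p + 1)"
  shows "q \<noteq> p" "(if q mod 4 = 3 then q - 3 else q + 1) \<noteq> p"
  unfolding assms by (cases p rule: nat_mod_4_cases; simp add: div_mod_4_simps)+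

lemma successor_div_mod_4:
  fixes p :: nat
  shows "(if p mod 4 = 3 then p - 3 else p + 1) div 4 = p div 4"
    and "(if p mod 4 = 3 then p - 3 else p + 1) mod 4 = (if p mod 4 = 3 then 0 else p mod 4 + 1)"
  by (atomize (full), cases p rule: nat_mod_4_cases) (simp_all add: div_mod_4_simps)

lemma successor_mod_4_inj:
  fixes p q :: nat
  assumes "(if p mod 4 = 3 then p - 3 else p + 1) = (if q mod 4 = 3 then q - 3 else q + 1)"
  shows "p = q"
proof -
  have "(if p mod 4 = 3 then 0 else p mod 4 + 1) = (if q mod 4 = 3 then 0 else q mod 4 + 1)"
    using successor_div_mod_4(2)[of p, unfolded assms]
    unfolding successor_div_mod_4(2)[of q] by (rule sym)
  hence "p mod 4 = q mod 4" by (auto split: if_splits)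
  moreover have "p div 4 = q div 4"
    using successor_div_mod_4(1)[of p, unfolded assms]
    unfolding successor_div_mod_4(1)[of q] by (rule sym)
  ultimately show ?thesis by (metis div_mult_mod_eq)
qed

lemma row_successor_less:
  assumes "v < 4 * n * (k + 1)"
  shows "row_successor n v < 4 * n * (k + 1)"
  using assms by (elim vertexE) (metis row_successor_position vertex_less)

text \<open>The successor never leaves its row, so the row can be read off the image; within a row
  it only shifts along cycles.\<close>

lemma inj_on_row_successor: "inj_on (row_successor n) {..<4 * n * (k + 1)}"
proof (rule inj_onI)
  fix u v assume "u \<in> {..<4 * n * (k + 1)}" "v \<in> {..<4 * n * (k + 1)}"
    and eq: "row_successor n u = row_successor n v"
  hence "u < 4 * n * (k + 1)" "v < 4 * n * (k + 1)" by simp_all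
  then obtain r p r' p' where u: "u = r * (4 * n) + p" "p < 4 * n"
    and v: "v = r' * (4 * n) + p'" "p' < 4 * n" by (metis vertexE)
  from row_successor_position[OF u(2), of r] obtain q where q: "q < 4 * n" "row_successor n u = r * (4 * n) + q"
    "q = (if r = 0 then if p mod 4 = 3 then p - 3 else p + 1 else if p = 4 * n - 1 then 0 else p + 1)"
    unfolding u(1) by metis
  from row_successor_position[OF v(2), of r'] obtain q' where q': "q' < 4 * n" "row_successor n v = r' * (4 * n) + q'"
    "q' = (if r' = 0 then if p' mod 4 = 3 then p' - 3 else p' + 1 else if p' = 4 * n - 1 then 0 else p' + 1)"
    unfolding v(1) by metis
  have "r = r'" "q = q'" using eq q(2) q'(2) vertex_eq_iff[OF q(1) q'(1)] by auto
  moreover have "p = p'"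
  proof (cases "r = 0")
    case True
    hence "(if p mod 4 = 3 then p - 3 else p + 1) = (if p' mod 4 = 3 then p' - 3 else p' + 1)"
      using \<open>r = r'\<close> \<open>q = q'\<close> q(3) q'(3) by simp
    thus ?thesis by (rule successor_mod_4_inj)
  next
    case False
    thus ?thesis using \<open>r = r'\<close> \<open>q = q'\<close> q(3) q'(3) u(2) v(2) by (auto split: if_splits)
  qed
  ultimately show "u = v" using u v by simp
qed

text \<open>Cycles have length 4 or \<open>4 * n\<close>, and the latter is at least 4 because a
  vertex exists.\<close>

lemma row_successor_twice:
  assumes "v < 4 * n * (k + 1)"
  shows "row_successor n (row_successor n v) \<noteq> v"
proof -
  obtain r p where v: "v = r * (4 * n) + p" "p < 4 * n" using vertexE[OF assms] by metis
  obtain q where q: "q < 4 * n" "row_successor n v = r * (4 * n) + q"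
    "q = (if r = 0 then if p mod 4 = 3 then p - 3 else p + 1 else if p = 4 * n - 1 then 0 else p + 1)"
    using row_successor_position[OF v(2), of r] v(1) by metis
  obtain q' where q': "q' < 4 * n" "row_successor n (row_successor n v) = r * (4 * n) + q'"
    "q' = (if r = 0 then if q mod 4 = 3 then q - 3 else q + 1 else if q = 4 * n - 1 then 0 else q + 1)"
    using row_successor_position[OF q(1), of r] q(2) by metis
  have "q' \<noteq> p"
  proof (cases "r = 0")
    case True
    thus ?thesis using successor_mod_4_twice(2)[of q p] q(3) q'(3) by simp
  next
    case False
    moreover obtain m where "n = Suc m" using v(2) by (cases n) auto
    ultimately show ?thesis using v(2) unfolding q'(3) q(3) by auto
  qed
  thus ?thesis using v q' by simp
qed

text \<open>A block number has the parity of its vertices, whereas a step along a cycle changes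
  parity; this is why vertices are paired at distance two. The argument below separates checks,
  numbered below \<open>4 * n\<close>, from pairs, numbered from \<open>4 * n\<close> on.\<close>

lemma column_block_row_successor:
  assumes "v < 4 * n * (k + 1)"
  shows "column_block n G (row_successor n v) \<noteq> column_block n G v"
proof -
  obtain r p where v: "v = r * (4 * n) + p" "p < 4 * n" using vertexE[OF assms] by metis
  obtain q where q: "q < 4 * n" "row_successor n v = r * (4 * n) + q"
    "q = (if r = 0 then if p mod 4 = 3 then p - 3 else p + 1 else if p = 4 * n - 1 then 0 else p + 1)"
    using row_successor_position[OF v(2), of r] v(1) by metis
  show ?thesis
  proof (cases "r = 0")
    case True
    have "p \<noteq> q" using True successor_mod_4_twice(1)[of q p] q(3) by simp
    thus ?thesis using column_block_vertex[OF v(2), of G 0] column_block_vertex[OF q(1), of G 0]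
      unfolding q(2) unfolding v(1) by (simp add: True)
  next
    case False
    define R where "R = r * (4 * n)"
    have "4 * n \<le> R" using False unfolding R_def by (cases r) auto
    moreover have "4 \<le> 4 * n" using v(2) by (cases n) auto
    ultimately have R: "4 * n \<le> R" "4 \<le> 4 * n" by blast+
    have q3: "q = (if p = 4 * n - 1 then 0 else p + 1)" using False q(3) by simp
    have "q \<noteq> p"
    proof (cases "p = 4 * n - 1")
      case True
      moreover have "q = 0" using True q3 by simp
      ultimately show ?thesis using R(2) by linarith
    qed (use q3 in simp)
    have "(if q mod 4 < 2 then R + q else R + q - 2) \<noteq> (if p mod 4 < 2 then R + p else R + p - 2)"
    proof (cases "p = 4 * n - 1")
      case True
      obtain m where m: "n = Suc m" using R(2) by (cases n) auto
      have "p = 3 + 4 * m" using True m by simp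
      hence "p mod 4 = 3" by simp
      moreover have "q = 0" using True q3 by simp
      ultimately show ?thesis using m True by simp
    next
      case False
      hence "q = Suc p" using q3 by simp
      thus ?thesis using R by (auto simp: mod_Suc)
    qed
    moreover have "(if u mod 4 < 2 then R + u else R + u - 2) \<ge> 4 * n" for u
    proof (cases "u < 2")
      case False
      thus ?thesis using R by auto
    qed (use R in simp)
    moreover define block where "block u = (if u mod 4 < 2 then R + u else R + u - 2)" for u
    ultimately have block: "block q \<noteq> block p" "4 * n \<le> block u" for u by simp_all
    have "column_block n G (R + u) \<in> {u, block u}" if "u < 4 * n" for u
      using column_block_vertex[OF that, of G r] by (auto simp: block_def R_def)
    hence "column_block n G (R + p) \<in> {p, block p}" "column_block n G (R + q) \<in> {q, block q}"
      using v(2) q(1) by auto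
    moreover have "row_successor n v = R + q" "v = R + p" using q(2) v(1) by (simp_all add: R_def)
    moreover have "p < block q" "q < block p"
      using block(2)[of p] block(2)[of q] v(2) q(1) by linarith+
    ultimately show ?thesis using block(1) \<open>q \<noteq> p\<close> by auto
  qed
qed

section \<open>Invariant sets with even blocks\<close>

text \<open>The union of whole cycles of \<open>row_successor\<close>: those of the coordinates in
  \<open>Y\<close> and of the generator rows in \<open>X\<close>. Row 0 of the vertices holds the
  coordinates, hence the shift by one.\<close>

definition layer_vertices :: "nat \<Rightarrow> nat \<Rightarrow> nat set \<Rightarrow> nat set \<Rightarrow> nat set" where
  "layer_vertices n k Y X = {v. v < 4 * n * (k + 1) \<and>
     (if v < 4 * n then v div 4 \<in> Y else v div (4 * n) - 1 \<in> X)}"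

lemma vertex_mem_layer_vertices:
  assumes "r \<le> k" "p < 4 * n"
  shows "r * (4 * n) + p \<in> layer_vertices n k Y X \<longleftrightarrow> (if r = 0 then p div 4 \<in> Y else r - 1 \<in> X)"
  using vertex_less[OF assms] vertex_div_mod[OF assms(2), of r]
  by (cases "r = 0") (simp_all add: layer_vertices_def)

text \<open>Membership depends on the cycle alone, which gives inclusion; injectivity on a finite
  set turns it into equality.\<close>

lemma row_successor_layer_vertices:
  "row_successor n ` layer_vertices n k Y X = layer_vertices n k Y X"
proof -
  have fin: "finite (layer_vertices n k Y X)" by (simp add: layer_vertices_def)
  have "row_successor n v \<in> layer_vertices n k Y X" if v: "v \<in> layer_vertices n k Y X" for v
  proof -
    have "v < 4 * n * (k + 1)" using v by (simp add: layer_vertices_def)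
    then obtain r p where rp: "v = r * (4 * n) + p" "r \<le> k" "p < 4 * n" by (rule vertexE)
    obtain q where q: "q < 4 * n" "row_successor n v = r * (4 * n) + q"
      "q = (if r = 0 then if p mod 4 = 3 then p - 3 else p + 1 else if p = 4 * n - 1 then 0 else p + 1)"
      using row_successor_position[OF rp(3), of r] rp(1) by metis
    have "q div 4 = p div 4" if "r = 0"
      using q(3) that successor_div_mod_4(1)[of p] by simp
    thus ?thesis using v unfolding q(2)
      unfolding rp(1) vertex_mem_layer_vertices[OF rp(2,3)] vertex_mem_layer_vertices[OF rp(2) q(1)]
      by (cases "r = 0") simp_all
  qed
  moreover have "inj_on (row_successor n) (layer_vertices n k Y X)"
    by (rule inj_on_subset[OF inj_on_row_successor[of n k]]) (auto simp: layer_vertices_def)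
  ultimately show ?thesis using fin by (intro endo_inj_surj) auto
qed

text \<open>An invariant set is a union of cycles, so one vertex of each cycle decides: the first
  copy for a coordinate, the first position for a row.\<close>

lemma row_successor_invariant:
  assumes n: "0 < n" and T: "T \<subseteq> {..<4 * n * (k + 1)}" "row_successor n ` T = T"
  shows "T = layer_vertices n k {j. j < n \<and> 4 * j \<in> T} {i. i < k \<and> (i + 1) * (4 * n) \<in> T}"
proof -
  \<comment> \<open>Injectivity makes invariance reversible, so membership can be followed along a
    cycle in both directions.\<close>
  have step: "row_successor n v \<in> T \<longleftrightarrow> v \<in> T" if "v < 4 * n * (k + 1)" for v
    using inj_on_image_mem_iff[OF inj_on_row_successor[of n k], of v T] that T by simp
  have row: "r * (4 * n) + p \<in> T \<longleftrightarrow> r * (4 * n) \<in> T" if r: "r \<le> k" "r \<noteq> 0" and "p < 4 * n" for r p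
    using \<open>p < 4 * n\<close>
  proof (induction p)
    case (Suc p)
    have "row_successor n (r * (4 * n) + p) = r * (4 * n) + Suc p"
      using row_successor_vertex[of p n r] Suc.prems r by simp
    thus ?case using step[OF vertex_less[of r k p n]] Suc r by simp
  qed simp
  have row0: "p \<in> T \<longleftrightarrow> 4 * (p div 4) \<in> T" if "p < 4 * n" for p
  proof -
    define j where "j = p div 4"
    have j: "4 * j + s < 4 * n" if "s < 4" for s
      using that \<open>p < 4 * n\<close> unfolding j_def by presburger
    have suc: "4 * j + s + 1 \<in> T \<longleftrightarrow> 4 * j + s \<in> T" if "s < 3" for s
    proof -
      have "(4 * j + s) mod 4 = s" using that by simp
      hence "row_successor n (4 * j + s) = 4 * j + s + 1"
        using row_successor_vertex[of "4 * j + s" n 0] j[of s] that by simp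
      thus ?thesis using step[of "4 * j + s"] vertex_less[of 0 k "4 * j + s" n] j[of s] that by simp
    qed
    have "p = 4 * j + p mod 4" unfolding j_def by simp
    moreover have "p mod 4 = 0 \<or> p mod 4 = 1 \<or> p mod 4 = 2 \<or> p mod 4 = 3" by linarith
    ultimately have "p \<in> {4 * j, 4 * j + 1, 4 * j + 2, 4 * j + 3}" by auto
    thus ?thesis using suc[of 0] suc[of 1] suc[of 2] unfolding j_def[symmetric]
      by (auto simp: eval_nat_numeral)
  qed
  have "v \<in> T \<longleftrightarrow> v \<in> layer_vertices n k {j. j < n \<and> 4 * j \<in> T} {i. i < k \<and> (i + 1) * (4 * n) \<in> T}"
    if v: "v < 4 * n * (k + 1)" for v
  proof -
    obtain r p where rp: "v = r * (4 * n) + p" "r \<le> k" "p < 4 * n" using v by (rule vertexE)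
    show ?thesis
    proof (cases "r = 0")
      case True
      thus ?thesis unfolding rp(1) vertex_mem_layer_vertices[OF rp(2,3)]
        using row0[OF rp(3)] rp(3) by (simp add: less_mult_imp_div_less mult.commute)
    next
      case False
      then obtain i where i: "r = Suc i" by (cases r) auto
      thus ?thesis unfolding rp(1) vertex_mem_layer_vertices[OF rp(2,3)]
        using row[OF rp(2) False rp(3)] rp(2) by simp
    qed
  qed
  moreover have "v < 4 * n * (k + 1)" if "v \<in> layer_vertices n k Y X" for v Y X
    using that by (simp add: layer_vertices_def)
  ultimately show ?thesis using T(1) by blast
qed

text \<open>Besides vertex \<open>c\<close> itself, check \<open>c\<close> contains the vertex at
  position \<open>c\<close> of each row whose generator entry is 1. The parity of the cardinality is
  thus the parity-check equation of coordinate \<open>c div 4\<close>.\<close>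

lemma card_column_block_layer:
  assumes X: "X \<subseteq> {..<k}" and c: "c < 4 * n"
  shows "card {v \<in> layer_vertices n k Y X. column_block n G v = c} =
    of_bool (c div 4 \<in> Y) + card {i\<in>X. G $$ (i, c div 4) = 1}"
proof -
  define f where "f i = (i + 1) * (4 * n) + c" for i
  have "v \<in> layer_vertices n k Y X \<and> column_block n G v = c \<longleftrightarrow>
      v \<in> (if c div 4 \<in> Y then {c} else {}) \<union> f ` {i\<in>X. G $$ (i, c div 4) = 1}" for v
  proof (cases "v < 4 * n * (k + 1)")
    case True
    then obtain r p where rp: "v = r * (4 * n) + p" "r \<le> k" "p < 4 * n" by (rule vertexE)
    show ?thesis
    proof (cases "r = 0")
      case True
      have "v \<notin> range f" using rp(1,3) True by (auto simp: f_def)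
      moreover have "column_block n G v = p" using column_block_vertex[OF rp(3), of G r] True rp(1) by simp
      ultimately show ?thesis
        using vertex_mem_layer_vertices[OF rp(2,3), of Y X] True rp(1) by auto
    next
      case False
      then obtain i where i: "r = Suc i" by (cases r) auto
      have "4 * n \<le> r * (4 * n)" using False by (cases r) auto
      hence "v \<noteq> c" using rp(1) c by linarith
      \<comment> \<open>Subtraction is truncated; \<open>2 \<le> p\<close> keeps the number of a
        pair at \<open>4 * n\<close> or above, away from \<open>c\<close>.\<close>
      moreover have "2 \<le> p" if "\<not> p mod 4 < 2" using that by (metis mod_less_eq_dividend not_less order_trans)
      ultimately have blk: "column_block n G v = c \<longleftrightarrow> G $$ (i, p div 4) = 1 \<and> p = c"
        using column_block_vertex[OF rp(3), of G r] False rp(1) i c \<open>4 * n \<le> r * (4 * n)\<close> by auto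
      have vf: "v = f i' \<longleftrightarrow> i' = i \<and> p = c" for i'
        unfolding f_def rp(1) vertex_eq_iff[OF rp(3) c] i by auto
      hence "v \<in> f ` {i\<in>X. G $$ (i, c div 4) = 1} \<longleftrightarrow> i \<in> X \<and> G $$ (i, c div 4) = 1 \<and> p = c"
        unfolding image_iff Bex_def vf by auto
      moreover have "v \<in> layer_vertices n k Y X \<longleftrightarrow> i \<in> X"
        using vertex_mem_layer_vertices[OF rp(2,3), of Y X] rp(1) i by simp
      ultimately show ?thesis using blk \<open>v \<noteq> c\<close> by auto
    qed
  next
    case False
    have "c < 4 * n * (k + 1)" using vertex_less[of 0 k c n] c by simp
    moreover have "f i < 4 * n * (k + 1)" if "i \<in> X" for i
      unfolding f_def by (rule vertex_less) (use that X c in auto)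
    ultimately show ?thesis using False by (auto simp: layer_vertices_def)
  qed
  hence eq: "{v \<in> layer_vertices n k Y X. column_block n G v = c} =
      (if c div 4 \<in> Y then {c} else {}) \<union> f ` {i\<in>X. G $$ (i, c div 4) = 1}" by blast
  have "inj f" unfolding inj_def f_def vertex_eq_iff[OF c c] by simp
  hence "card (f ` {i\<in>X. G $$ (i, c div 4) = 1}) = card {i\<in>X. G $$ (i, c div 4) = 1}"
    by (rule card_image[OF inj_on_subset]) simp
  moreover have "c \<notin> f ` {i\<in>X. G $$ (i, c div 4) = 1}" using c by (auto simp: f_def)
  moreover have "finite X" using X finite_subset by blast
  ultimately show ?thesis unfolding eq by simp
qed

text \<open>If such a block meets the set, the intersection is \<open>{c, c + 2}\<close>: both
  copies belong to one row cycle and are taken together.\<close>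

lemma even_card_pair_block:
  assumes c: "4 * n \<le> c"
  shows "even (card {v \<in> layer_vertices n k Y X. column_block n G v = c})" (is "even (card ?S)")
proof (cases "?S = {}")
  case True
  show ?thesis unfolding True by simp
next
  case False
  then obtain v where v: "v \<in> layer_vertices n k Y X" "column_block n G v = c" by auto
  have "v < 4 * n * (k + 1)" using v by (simp add: layer_vertices_def)
  then obtain r p where rp: "v = r * (4 * n) + p" "r \<le> k" "p < 4 * n" by (rule vertexE)
  have inv: "r \<noteq> 0" "G $$ (r - 1, p div 4) \<noteq> 1"
    using column_block_vertex[OF rp(3), of G r] v(2) rp(1,3) c by (auto split: if_splits)
  have X: "r - 1 \<in> X" using vertex_mem_layer_vertices[OF rp(2,3), of Y X] v(1) rp(1) inv(1) by simp
  obtain j s where js: "s < 2" "p = 4 * j + s \<or> p = 4 * j + s + 2"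
  proof (cases p rule: nat_mod_4_cases)
    case (1 j)
    thus ?thesis using that[of 0 j] by simp
  next
    case (2 j)
    thus ?thesis using that[of 1 j] by simp
  next
    case (3 j)
    thus ?thesis using that[of 0 j] by simp
  next
    case (4 j)
    thus ?thesis using that[of 1 j] by simp
  qed
  have pos: "4 * j + t < 4 * n" "(4 * j + t) div 4 = j" "(4 * j + t) mod 4 = t" if "t < 4" for t
  proof -
    show "4 * j + t < 4 * n" using that rp(3) js by presburger
  qed (use that in auto)
  have j: "p div 4 = j" using js pos(2)[of s] pos(2)[of "s + 2"] by (auto simp: add.assoc)
  have block: "column_block n G (r * (4 * n) + (4 * j + t)) =
      r * (4 * n) + 4 * j + (if t < 2 then t else t - 2)" if "t < 4" for t
    using column_block_vertex[OF pos(1)[OF that], of G r] pos(2,3)[OF that] inv j by auto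
  have "c = r * (4 * n) + 4 * j + s"
    using block[of s] block[of "s + 2"] js v(2) unfolding rp(1) by (auto simp: add.assoc)
  moreover have layer: "r * (4 * n) + (4 * j + t) \<in> layer_vertices n k Y X" if "t < 4" for t
    using vertex_mem_layer_vertices[OF rp(2) pos(1)[OF that], of Y X] X inv(1) by simp
  ultimately have "c \<in> ?S" "c + 2 \<in> ?S"
    using block[of s] block[of "s + 2"] layer[of s] layer[of "s + 2"] js(1) by (auto simp: add.assoc)
  \<comment> \<open>The position of \<open>u\<close> is too small to equal \<open>c\<close>, and
    \<open>u - 2 = c\<close> involves no truncation because \<open>c\<close> is at least 4.\<close>
  moreover have "u \<in> {c, c + 2}" if "u \<in> ?S" for u
  proof -
    have "u < 4 * n * (k + 1)" "column_block n G u = c" using that by (auto simp: layer_vertices_def)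
    then obtain r' p' where u: "u = r' * (4 * n) + p'" "p' < 4 * n" using vertexE by metis
    have "column_block n G u \<in> {p', u, u - 2}" using column_block_vertex[OF u(2), of G r'] u(1) by auto
    moreover have "4 \<le> 4 * n" using u(2) by (cases n) auto
    ultimately show ?thesis using c \<open>column_block n G u = c\<close> u(2) by auto
  qed
  ultimately have "?S = {c, c + 2}" by blast
  thus ?thesis by simp
qed

text \<open>Pairs impose nothing, and the four checks of a coordinate \<open>j\<close> impose the
  same equation, equating its bit in \<open>Y\<close> with the parity of column \<open>j\<close>
  over \<open>X\<close>.\<close>

lemma even_column_blocks_iff:
  assumes "X \<subseteq> {..<k}" "Y \<subseteq> {..<n}"
  shows "(\<forall>c. even (card {v \<in> layer_vertices n k Y X. column_block n G v = c})) \<longleftrightarrow>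
    Y = parity_support n G X"
proof
  assume even: "\<forall>c. even (card {v \<in> layer_vertices n k Y X. column_block n G v = c})"
  have "j \<in> Y \<longleftrightarrow> odd (card {i\<in>X. G $$ (i, j) = 1})" if "j < n" for j
  proof -
    have "even (of_bool (4 * j div 4 \<in> Y) + card {i\<in>X. G $$ (i, 4 * j div 4) = 1})"
      using even that by (subst card_column_block_layer[OF assms(1), symmetric, of _ n]) simp_all
    thus ?thesis by (cases "j \<in> Y") simp_all
  qed
  thus "Y = parity_support n G X" using assms(2) by (auto simp: parity_support_def)
next
  assume Y: "Y = parity_support n G X"
  show "\<forall>c. even (card {v \<in> layer_vertices n k Y X. column_block n G v = c})"
  proof
    fix c
    show "even (card {v \<in> layer_vertices n k Y X. column_block n G v = c})"
    proof (cases "c < 4 * n")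
      case True
      hence "c div 4 < n" by auto
      thus ?thesis unfolding card_column_block_layer[OF assms(1) True]
        by (auto simp: Y parity_support_def)
    next
      case False
      thus ?thesis by (intro even_card_pair_block) simp
    qed
  qed
qed

lemma sum_vertex_weight_layer_vertices:
  assumes "Y \<subseteq> {..<n}"
  shows "sum (vertex_weight n w) (layer_vertices n k Y X) = sum w Y"
proof -
  have Y: "4 * j \<in> layer_vertices n k Y X" "vertex_weight n w (4 * j) = w j" if "j \<in> Y" for j
    using that assms vertex_mem_layer_vertices[of 0 k "4 * j" n Y X] by (auto simp: vertex_weight_def)
  have "sum (vertex_weight n w) (layer_vertices n k Y X) = sum (vertex_weight n w) ((*) 4 ` Y)"
  proof (rule sum.mono_neutral_right)
    show "finite (layer_vertices n k Y X)" by (simp add: layer_vertices_def)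
    show "(*) 4 ` Y \<subseteq> layer_vertices n k Y X" using Y(1) by blast
    show "\<forall>v\<in>layer_vertices n k Y X - (*) 4 ` Y. vertex_weight n w v = 0"
    proof
      fix v assume v: "v \<in> layer_vertices n k Y X - (*) 4 ` Y"
      show "vertex_weight n w v = 0"
      proof (cases "v < 4 * n \<and> v mod 4 = 0")
        case True
        hence "v = 4 * (v div 4)" "v div 4 \<in> Y" using v by (auto simp: layer_vertices_def)
        thus ?thesis using v by blast
      qed (auto simp: vertex_weight_def)
    qed
  qed
  also have "\<dots> = (\<Sum>j\<in>Y. vertex_weight n w (4 * j))"
    by (subst sum.reindex) (auto simp: inj_on_def)
  also have "\<dots> = sum w Y" using Y by simp
  finally show ?thesis .
qed

text \<open>The checks express \<open>Y\<close> through \<open>X\<close>, so the surviving sets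
  correspond to sets of generator rows; \<open>Xs\<close> reads the rows off the first vertices of
  their cycles.\<close>

lemma sum_even_invariant_sets:
  assumes "n = 0 \<Longrightarrow> k = 0"
  shows "(\<Sum>T | T \<subseteq> {..<4 * n * (k + 1)} \<and> row_successor n ` T = T \<and>
      (\<forall>c. even (card {v\<in>T. column_block n G v = c})). zpow (sum (vertex_weight n w) T)) =
    (\<Sum>X\<in>Pow {..<k}. zpow (sum w (parity_support n G X)))"
proof (cases "n = 0")
  \<comment> \<open>There are no vertices, and \<open>k = 0\<close> leaves a single term on the
    other side too.\<close>
  case True
  hence "{T. T \<subseteq> {..<4 * n * (k + 1)} \<and> row_successor n ` T = T \<and>
      (\<forall>c. even (card {v\<in>T. column_block n G v = c}))} = {{}}" by auto
  thus ?thesis using assms True by (simp add: parity_support_def)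
next
  case False
  define Xs where "Xs T = {i. i < k \<and> (i + 1) * (4 * n) \<in> T}" for T
  have sub: "parity_support n G X \<subseteq> {..<n}" for X by (auto simp: parity_support_def)
  show ?thesis
  proof (rule sum.reindex_bij_witness[where j = Xs and
        i = "\<lambda>X. layer_vertices n k (parity_support n G X) X"])
    fix T assume "T \<in> {T. T \<subseteq> {..<4 * n * (k + 1)} \<and> row_successor n ` T = T \<and>
      (\<forall>c. even (card {v\<in>T. column_block n G v = c}))}"
    hence T: "T \<subseteq> {..<4 * n * (k + 1)}" "row_successor n ` T = T"
      "\<forall>c. even (card {v\<in>T. column_block n G v = c})" by auto
    define Y where "Y = {j. j < n \<and> 4 * j \<in> T}"
    have eq: "T = layer_vertices n k Y (Xs T)"
      using row_successor_invariant[OF _ T(1,2)] False by (simp add: Xs_def Y_def)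
    have "Y = parity_support n G (Xs T)"
      using even_column_blocks_iff[of "Xs T" k Y n G] T(3) eq by (auto simp: Xs_def Y_def)
    thus *: "layer_vertices n k (parity_support n G (Xs T)) (Xs T) = T" using eq by simp
    show "Xs T \<in> Pow {..<k}" by (auto simp: Xs_def)
    show "zpow (sum w (parity_support n G (Xs T))) = zpow (sum (vertex_weight n w) T)"
      using sum_vertex_weight_layer_vertices[OF sub[of "Xs T"], of w k "Xs T"] unfolding * by simp
  next
    fix X assume "X \<in> Pow {..<k}"
    hence X: "X \<subseteq> {..<k}" by simp
    show "layer_vertices n k (parity_support n G X) X \<in> {T. T \<subseteq> {..<4 * n * (k + 1)} \<and> row_successor n ` T = T \<and>
      (\<forall>c. even (card {v\<in>T. column_block n G v = c}))}"
      using row_successor_layer_vertices even_column_blocks_iff[OF X sub[of X], of G]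
      by (auto simp: layer_vertices_def)
    have "(i + 1) * (4 * n) \<in> layer_vertices n k (parity_support n G X) X \<longleftrightarrow> i \<in> X" if "i < k" for i
      using vertex_mem_layer_vertices[of "i + 1" k 0 n "parity_support n G X" X] that False by simp
    thus "Xs (layer_vertices n k (parity_support n G X) X) = X" using X by (auto simp: Xs_def)
  qed
qed

section \<open>Codewords as sums of rows\<close>

definition subset_codeword :: "nat \<Rightarrow> bit mat \<Rightarrow> nat set \<Rightarrow> bit vec" where
  "subset_codeword n G X = vec n (\<lambda>j. of_bool (j \<in> parity_support n G X))"

lemma sum_bit_eq: "(\<Sum>x\<in>A. f x) = (of_bool (odd (card {x\<in>A. f x = 1})) :: bit)" if "finite A"
  using that
proof (induction A rule: finite_induct)
  case (insert a A)
  have "{x \<in> insert a A. f x = 1} = (if f a = 1 then insert a {x\<in>A. f x = 1} else {x\<in>A. f x = 1})"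
    by auto
  thus ?case using insert by (cases "f a") auto
qed simp

lemma mult_indicator_eq_subset_codeword:
  assumes G: "G \<in> carrier_mat k n" and y: "y \<in> carrier_vec k"
  shows "G\<^sup>T *\<^sub>v y = subset_codeword n G {i. i < k \<and> y $ i = 1}"
proof (rule eq_vecI)
  fix j assume "j < dim_vec (subset_codeword n G {i. i < k \<and> y $ i = 1})"
  hence j: "j < n" by (simp add: subset_codeword_def)
  have "(G\<^sup>T *\<^sub>v y) $ j = (\<Sum>i = 0..<k. G $$ (i, j) * y $ i)"
    using G y j by (simp add: scalar_prod_def)
  also have "\<dots> = of_bool (odd (card {i \<in> {0..<k}. G $$ (i, j) * y $ i = 1}))"
    by (rule sum_bit_eq) simp
  also have "{i \<in> {0..<k}. G $$ (i, j) * y $ i = 1} = {i \<in> {i. i < k \<and> y $ i = 1}. G $$ (i, j) = 1}"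
  proof -
    have "a * b = 1 \<longleftrightarrow> a = 1 \<and> b = 1" for a b :: bit by (cases a; cases b) simp_all
    thus ?thesis by auto
  qed
  finally show "(G\<^sup>T *\<^sub>v y) $ j = subset_codeword n G {i. i < k \<and> y $ i = 1} $ j"
    using j by (simp add: subset_codeword_def parity_support_def)
qed (use G in \<open>simp add: subset_codeword_def\<close>)

lemma code_weight_subset_codeword:
  "code_weight w (subset_codeword n G X) = sum w (parity_support n G X)"
  unfolding code_weight_def
  by (rule sum.cong) (auto simp: subset_codeword_def parity_support_def)

text \<open>The product is the combination of the rows with coefficients \<open>y\<close>, so this
  is their independence; the work lies in passing from a set of rows to indexed rows.\<close>

lemma generator_matrix_kernel:
  assumes "generator_matrix k n G C" "y \<in> carrier_vec k" "G\<^sup>T *\<^sub>v y = 0\<^sub>v n"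
  shows "y = 0\<^sub>v k"
proof -
  interpret vec_space "TYPE(bit)" n .
  have G: "G \<in> carrier_mat k n" "distinct (rows G)" "lin_indpt (set (rows G))"
    using assms(1) by (auto simp: generator_matrix_def)
  have rows: "set (rows G) \<subseteq> carrier_vec n" using G(1) rows_carrier by blast
  have len: "length (rows G) = k" using G(1) by simp
  \<comment> \<open>Combinations over a set take coefficients on vectors; distinctness of the rows
    makes the index of a row unique.\<close>
  define a where "a v = y $ (THE i. i < k \<and> rows G ! i = v)" for v
  have a: "a (rows G ! i) = y $ i" if "i < k" for i
  proof -
    have "(THE i'. i' < k \<and> rows G ! i' = rows G ! i) = i"
      using that nth_eq_iff_index_eq[OF G(2)] unfolding len by (intro the_equality) blast+
    thus ?thesis by (simp add: a_def)
  qed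
  have "lincomb a (set (rows G)) = lincomb_list (\<lambda>i. a (rows G ! i)) (rows G)"
    by (rule lincomb_as_lincomb_list_distinct[OF rows G(2)])
  also have "\<dots> = mat_of_cols n (rows G) *\<^sub>v vec (length (rows G)) (\<lambda>i. a (rows G ! i))"
    by (rule lincomb_list_as_mat_mult) (use rows in auto)
  also have "mat_of_cols n (rows G) = G\<^sup>T"
    using G(1) by (intro eq_matI) (auto simp: mat_of_cols_def)
  also have "vec (length (rows G)) (\<lambda>i. a (rows G ! i)) = y"
    using assms(2) len a by (intro eq_vecI) auto
  finally have "lincomb a (set (rows G)) = 0\<^sub>v n" using assms(3) by simp
  hence "a v = 0" if "v \<in> set (rows G)" for v
    using not_lindepD[OF G(3), of "set (rows G)" a] that by (auto simp: module_vec_simps)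
  hence "y $ i = 0" if "i < k" for i using a[OF that] that len by (metis nth_mem)
  thus ?thesis using assms(2) by (intro eq_vecI) auto
qed

text \<open>Coefficient vectors over the two-element field are sets of rows. Independence makes
  their sums distinct, and together these exhaust the row space.\<close>

lemma weight_enumerator_eq:
  assumes "generator_matrix k n G C"
  shows "weight_enumerator C w = (\<Sum>X\<in>Pow {..<k}. zpow (sum w (parity_support n G X)))"
proof -
  interpret vec_space "TYPE(bit)" n .
  have G: "G \<in> carrier_mat k n" "C = row_space G"
    using assms by (auto simp: generator_matrix_def)
  define ind where "ind X = vec k (\<lambda>i. of_bool (i \<in> X) :: bit)" for X
  have ind: "ind X \<in> carrier_vec k" "{i. i < k \<and> ind X $ i = 1} = X" if "X \<subseteq> {..<k}" for X
    using that by (auto simp: ind_def)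
  have cw: "subset_codeword n G X = G\<^sup>T *\<^sub>v ind X" if "X \<subseteq> {..<k}" for X
    using mult_indicator_eq_subset_codeword[OF G(1) ind(1)[OF that]] ind(2)[OF that] by simp
  have "inj_on (subset_codeword n G) (Pow {..<k})"
  proof (rule inj_onI)
    fix X Y assume XY: "X \<in> Pow {..<k}" "Y \<in> Pow {..<k}"
      and eq: "subset_codeword n G X = subset_codeword n G Y"
    have c: "ind X \<in> carrier_vec k" "ind Y \<in> carrier_vec k" using ind XY by auto
    have "G\<^sup>T *\<^sub>v (ind X - ind Y) = G\<^sup>T *\<^sub>v ind X - G\<^sup>T *\<^sub>v ind Y"
      using G(1) c by (intro mult_minus_distrib_mat_vec) auto
    also have "\<dots> = 0\<^sub>v n" using eq cw XY G(1) by auto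
    finally have "ind X - ind Y = 0\<^sub>v k"
      by (intro generator_matrix_kernel[OF assms]) (use c in auto)
    hence diff: "(ind X - ind Y) $ i = 0" if "i < k" for i using that by simp
    have "ind X $ i = ind Y $ i" if "i < k" for i
      using diff[OF that] that c by (cases "ind X $ i"; cases "ind Y $ i") auto
    hence "ind X = ind Y" using c by (intro eq_vecI) auto
    thus "X = Y" using ind(2) XY by (metis PowD)
  qed
  moreover have "subset_codeword n G ` Pow {..<k} = C"
  proof -
    have C: "c \<in> C \<longleftrightarrow> (\<exists>y\<in>carrier_vec k. G\<^sup>T *\<^sub>v y = c)" for c
      unfolding G(2) row_space_eq[OF G(1)] using G(1) by auto
    have im: "G\<^sup>T *\<^sub>v y \<in> subset_codeword n G ` Pow {..<k}" if "y \<in> carrier_vec k" for y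
      unfolding mult_indicator_eq_subset_codeword[OF G(1) that] by (rule imageI) auto
    have "subset_codeword n G X \<in> C" if "X \<in> Pow {..<k}" for X
      using C cw[of X] ind(1)[of X] that by auto
    hence "subset_codeword n G ` Pow {..<k} \<subseteq> C" by (rule image_subsetI)
    moreover have "C \<subseteq> subset_codeword n G ` Pow {..<k}"
    proof
      fix c assume "c \<in> C"
      then obtain y where "y \<in> carrier_vec k" "G\<^sup>T *\<^sub>v y = c" using C by blast
      thus "c \<in> subset_codeword n G ` Pow {..<k}" using im[of y] by simp
    qed
    ultimately show ?thesis by (rule subset_antisym)
  qed
  ultimately show ?thesis
    unfolding weight_enumerator_def
    by (subst sum.reindex_cong[of "subset_codeword n G" "Pow {..<k}" C]) (auto simp: code_weight_subset_codeword)
qed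

text \<open>For length 0 the transpose sends every vector to the empty one, so a trivial kernel
  forbids the all-ones vector of positive length \<open>k\<close>.\<close>

lemma generator_matrix_length_0:
  assumes "generator_matrix k 0 G C"
  shows "k = 0"
proof (rule ccontr)
  assume "k \<noteq> 0"
  have G: "G \<in> carrier_mat k 0" using assms by (simp add: generator_matrix_def)
  have "vec k (\<lambda>_. 1) = (0\<^sub>v k :: bit vec)"
    by (rule generator_matrix_kernel[OF assms]) (use G in auto)
  hence "vec k (\<lambda>_. 1 :: bit) $ 0 = 0\<^sub>v k $ 0" by simp
  thus False using \<open>k \<noteq> 0\<close> by simp
qed

section \<open>Programs with time bounds\<close>

primrec loop_free :: "com \<Rightarrow> bool" where
  "loop_free Skip = True"
| "loop_free (SetReg x e) = True"
| "loop_free (SetArr x i e) = True"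
| "loop_free (SetRArr x i e) = True"
| "loop_free (Seq c c') = (loop_free c \<and> loop_free c')"
| "loop_free (Cond b c c') = (loop_free c \<and> loop_free c')"
| "loop_free (While b c) = False"

text \<open>The clause for \<open>While\<close> is a dummy: \<open>run\<close> is meant for
  loop-free programs.\<close>

primrec run :: "com \<Rightarrow> ram_state \<Rightarrow> ram_state" where
  "run Skip s = s"
| "run (SetReg x e) s = s\<lparr>reg := (reg s)(x := nval e s)\<rparr>"
| "run (SetArr x i e) s = s\<lparr>arr := (arr s)(x := (arr s x)(nval i s := nval e s))\<rparr>"
| "run (SetRArr x i e) s = s\<lparr>rarr := (rarr s)(x := (rarr s x)(nval i s := rval e s))\<rparr>"
| "run (Seq c c') s = run c' (run c s)"
| "run (Cond b c c') s = (if bval b s then run c s else run c' s)"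
| "run (While b c) s = s"

text \<open>Both branches of a conditional are added, a crude bound that is still a constant of the
  program; the 0 for \<open>While\<close> is a dummy.\<close>

primrec max_steps :: "com \<Rightarrow> nat" where
  "max_steps Skip = 1"
| "max_steps (SetReg x e) = 1"
| "max_steps (SetArr x i e) = 1"
| "max_steps (SetRArr x i e) = 1"
| "max_steps (Seq c c') = max_steps c + max_steps c'"
| "max_steps (Cond b c c') = max_steps c + max_steps c' + 1"
| "max_steps (While b c) = 0"

lemma exec_run: "loop_free c \<Longrightarrow> \<exists>T \<le> max_steps c. exec c s T (run c s)"
proof (induction c arbitrary: s)
  case (Seq c c')
  obtain T where "T \<le> max_steps c" "exec c s T (run c s)" using Seq by fastforce
  moreover obtain T' where "T' \<le> max_steps c'" "exec c' (run c s) T' (run c' (run c s))"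
    using Seq by fastforce
  ultimately show ?case by (intro exI[of _ "T + T'"]) (auto intro: exec_Seq)
next
  case (Cond b c c')
  show ?case
  proof (cases "bval b s")
    case True
    obtain T where "T \<le> max_steps c" "exec c s T (run c s)" using Cond by fastforce
    thus ?thesis using True by (intro exI[of _ "T + 1"]) (auto intro!: exec_CondTrue simp del: One_nat_def add_Suc_right)
  next
    case False
    obtain T where "T \<le> max_steps c'" "exec c' s T (run c' s)" using Cond by fastforce
    thus ?thesis using False by (intro exI[of _ "T + 1"]) (auto intro!: exec_CondFalse simp del: One_nat_def add_Suc_right)
  qed
qed (auto intro: exec.intros[simplified])

text \<open>A total-correctness judgement with a time bound. It asks for some halting run, as
  \<open>constructs_within\<close> does.\<close>

definition reaches :: "com \<Rightarrow> nat \<Rightarrow> ram_state \<Rightarrow> (ram_state \<Rightarrow> bool) \<Rightarrow> bool" where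
  "reaches c B s Q \<longleftrightarrow> (\<exists>T s'. exec c s T s' \<and> T \<le> B \<and> Q s')"

lemma reaches_loop_free:
  assumes "loop_free c" "max_steps c \<le> B" "Q (run c s)"
  shows "reaches c B s Q"
  using exec_run[OF assms(1), of s] assms(2,3) unfolding reaches_def by (meson le_trans)

lemma reaches_Seq:
  assumes "reaches c B s P" "\<And>s'. P s' \<Longrightarrow> reaches c' B' s' Q" "B + B' \<le> D"
  shows "reaches (Seq c c') D s Q"
proof -
  obtain T s' where 1: "exec c s T s'" "T \<le> B" "P s'" using assms(1) by (auto simp: reaches_def)
  obtain T' s'' where 2: "exec c' s' T' s''" "T' \<le> B'" "Q s''" using assms(2)[OF 1(3)] by (auto simp: reaches_def)
  have "T + T' \<le> D" using 1(2) 2(2) assms(3) by linarith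
  thus ?thesis using exec_Seq[OF 1(1) 2(1)] 2(3) by (auto simp: reaches_def)
qed

lemma reaches_mono:
  assumes "reaches c B s P" "B \<le> D" "\<And>s'. P s' \<Longrightarrow> Q s'"
  shows "reaches c D s Q"
  using assms unfolding reaches_def by (meson le_trans)

text \<open>The invariant is indexed by the completed rounds, which fixes their number to
  \<open>m\<close>. Each round costs the body and one test; the last \<open>+ 1\<close> is the
  failing test.\<close>

lemma reaches_While:
  assumes init: "Inv 0 s"
    and step: "\<And>i s. i < m \<Longrightarrow> Inv i s \<Longrightarrow> bval b s \<and> reaches c B s (Inv (Suc i))"
    and exit: "\<And>s. Inv m s \<Longrightarrow> \<not> bval b s"
  shows "reaches (While b c) (m * (B + 1) + 1) s (Inv m)"
proof -
  have "reaches (While b c) ((m - i) * (B + 1) + 1) s (Inv m)" if "i \<le> m" "Inv i s" for i s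
    using that
  proof (induction i arbitrary: s rule: inc_induct)
    case base
    thus ?case using exec_WhileFalse[of b s c] exit by (auto simp: reaches_def)
  next
    case (step i)
    obtain T s' where 1: "bval b s" "exec c s T s'" "T \<le> B" "Inv (Suc i) s'"
      using assms(2)[OF step(2) step(4)] by (auto simp: reaches_def)
    obtain T' s'' where 2: "exec (While b c) s' T' s''" "T' \<le> (m - Suc i) * (B + 1) + 1" "Inv m s''"
      using step(3)[OF 1(4)] by (auto simp: reaches_def)
    have "m - i = Suc (m - Suc i)" using step(2) by simp
    hence "T + T' + 1 \<le> (m - i) * (B + 1) + 1" using 1(3) 2(2) by simp
    thus ?case using exec_WhileTrue[OF 1(1,2) 2(1)] 2(3) unfolding reaches_def by blast
  qed
  from this[of 0 s] init show ?thesis by simp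
qed

fun seqs :: "com list \<Rightarrow> com" where
  "seqs [] = Skip"
| "seqs (c # cs) = Seq c (seqs cs)"

abbreviation incr :: "nat \<Rightarrow> nat \<Rightarrow> com" where
  "incr x m \<equiv> SetReg x (NPlus (NReg x) (NConst m))"

abbreviation nreg_plus :: "nat \<Rightarrow> nat \<Rightarrow> nexp" where
  "nreg_plus x m \<equiv> NPlus (NReg x) (NConst m)"

definition NEq :: "nexp \<Rightarrow> nexp \<Rightarrow> bexp" where
  "NEq e e' = Conj (Neg (NLess e e')) (Neg (NLess e' e))"

lemma bval_NEq [simp]: "bval (NEq e e') s \<longleftrightarrow> nval e s = nval e' s"
  by (auto simp: NEq_def)

text \<open>
  Arrays 4 and 5 hold the permutation and the blocks, real array 1 the vertex weights; register 2 is
  the next vertex and register 6 the next cell of the generator matrix. The arcs are written over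
  the input.
\<close>

definition weight_row_body :: com where
  "weight_row_body = seqs
     [SetRArr 1 (NReg 2) (RArr 0 (NReg 3)),
      SetArr 4 (NReg 2) (nreg_plus 2 1), SetArr 4 (nreg_plus 2 1) (nreg_plus 2 2),
      SetArr 4 (nreg_plus 2 2) (nreg_plus 2 3), SetArr 4 (nreg_plus 2 3) (NReg 2),
      SetArr 5 (NReg 2) (NReg 2), SetArr 5 (nreg_plus 2 1) (nreg_plus 2 1),
      SetArr 5 (nreg_plus 2 2) (nreg_plus 2 2), SetArr 5 (nreg_plus 2 3) (nreg_plus 2 3),
      incr 2 4, incr 3 1]"

text \<open>Without multiplication, register 7 obtains \<open>4 * j\<close> by additions, and
  register 6 runs through the row-major matrix cells instead of computing
  \<open>i * n + j\<close>.\<close>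

definition code_row_body :: com where
  "code_row_body = seqs
     [SetArr 4 (NReg 2) (nreg_plus 2 1), SetArr 4 (nreg_plus 2 1) (nreg_plus 2 2),
      SetArr 4 (nreg_plus 2 2) (nreg_plus 2 3), SetArr 4 (nreg_plus 2 3) (nreg_plus 2 4),
      SetReg 7 (NPlus (NPlus (NReg 3) (NReg 3)) (NPlus (NReg 3) (NReg 3))),
      Cond (NLess (NConst 0) (NArr 0 (NReg 6)))
        (seqs [SetArr 5 (NReg 2) (NReg 7), SetArr 5 (nreg_plus 2 1) (nreg_plus 7 1),
          SetArr 5 (nreg_plus 2 2) (nreg_plus 7 2), SetArr 5 (nreg_plus 2 3) (nreg_plus 7 3)])
        (seqs [SetArr 5 (NReg 2) (NReg 2), SetArr 5 (nreg_plus 2 1) (nreg_plus 2 1),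
          SetArr 5 (nreg_plus 2 2) (NReg 2), SetArr 5 (nreg_plus 2 3) (nreg_plus 2 1)]),
      incr 2 4, incr 6 1, incr 3 1]"

text \<open>
  The body makes the last vertex of a row point past the end of the row, hence the correction after
  the loop.
\<close>

definition code_row :: com where
  "code_row = Seq (Seq (SetReg 5 (NReg 2)) (SetReg 3 (NConst 0)))
     (Seq (While (NLess (NReg 3) (NReg 0)) code_row_body)
       (Seq (SetArr 4 (NMinus (NReg 2) (NConst 1)) (NReg 5)) (incr 4 1)))"

text \<open>Registers 3 and 4 run through the two free coordinates \<open>c\<close> and
  \<open>a\<close>; \<open>d\<close> and \<open>b\<close> are looked up as iterated successors of
  \<open>c\<close>.\<close>

definition arc_body :: com where
  "arc_body = Seq
     (Cond (Conj (NEq (NArr 5 (NReg 4)) (NArr 5 (NArr 4 (NReg 3)))) (Neg (NEq (NReg 4) (NArr 4 (NReg 3)))))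
       (seqs [SetArr 0 (NReg 1) (NReg 4), SetArr 1 (NReg 1) (NArr 4 (NArr 4 (NReg 3))),
         SetArr 2 (NReg 1) (NReg 3), SetArr 3 (NReg 1) (NArr 4 (NReg 3)),
         SetRArr 0 (NReg 1) (RArr 1 (NArr 4 (NReg 3))), incr 1 1])
       Skip)
     (incr 4 1)"

definition arc_row :: com where
  "arc_row = Seq (SetReg 4 (NConst 0))
     (Seq (While (NLess (NReg 4) (NReg 0)) arc_body) (incr 3 1))"

text \<open>The number of vertices is taken over from register 2, the next free vertex, so it too is
  obtained by additions.\<close>

definition hypergraph_program :: com where
  "hypergraph_program =
     Seq (While (NLess (NReg 3) (NReg 0)) weight_row_body)
       (Seq (While (NLess (NReg 4) (NReg 1)) code_row)
         (Seq (seqs [SetReg 0 (NReg 2), SetReg 1 (NConst 0), SetReg 3 (NConst 0)])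
           (While (NLess (NReg 3) (NReg 0)) arc_row)))"

section \<open>Loop invariants and correctness of the program\<close>

lemma fill_four:
  fixes f h :: "nat \<Rightarrow> 'a"
  assumes "\<forall>v<m. f v = h v" "h m = a" "h (m + 1) = b" "h (m + 2) = c" "h (m + 3) = d"
  shows "\<forall>v<m + 4. (f(m := a, m + 1 := b, m + 2 := c, m + 3 := d)) v = h v"
proof (intro allI impI)
  fix v assume "v < m + 4"
  hence "v < m \<or> v = m \<or> v = m + 1 \<or> v = m + 2 \<or> v = m + 3" by linarith
  thus "(f(m := a, m + 1 := b, m + 2 := c, m + 3 := d)) v = h v" using assms by auto
qed

definition rows_stored :: "nat \<Rightarrow> bit mat \<Rightarrow> nat \<Rightarrow> ram_state \<Rightarrow> bool" where
  "rows_stored n G m s \<longleftrightarrow>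
     (\<forall>v<m. arr s 4 v = row_successor n v) \<and> (\<forall>v<m. arr s 5 v = column_block n G v)"

lemma weight_row_loop:
  assumes s: "s = input_state k n G w"
  shows "reaches (While (NLess (NReg 3) (NReg 0)) weight_row_body) (n * 13 + 1) s
    (\<lambda>s'. reg s' 0 = n \<and> reg s' 1 = k \<and> reg s' 2 = 4 * n \<and> reg s' 4 = 0 \<and> reg s' 6 = 0 \<and>
      arr s' 0 = arr s 0 \<and> rarr s' 1 = vertex_weight n w \<and> rows_stored n G (4 * n) s')"
proof -
  \<comment> \<open>Real array 1 is described on all cells: the later copies and all further rows
    have weight 0 because their cells are never written.\<close>
  define Inv where "Inv j s' \<longleftrightarrow> reg s' 0 = n \<and> reg s' 1 = k \<and> reg s' 2 = 4 * j \<and> reg s' 3 = j \<and>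
      reg s' 4 = 0 \<and> reg s' 6 = 0 \<and> arr s' 0 = arr s 0 \<and> rarr s' 0 = rarr s 0 \<and>
      rarr s' 1 = (\<lambda>v. if v < 4 * j then vertex_weight n w v else 0) \<and> rows_stored n G (4 * j) s'"
    for j s'
  \<comment> \<open>Eleven assignments and the closing \<open>Skip\<close> of \<open>seqs\<close>
    make 12.\<close>
  have "reaches (While (NLess (NReg 3) (NReg 0)) weight_row_body) (n * (12 + 1) + 1) s (Inv n)"
  proof (rule reaches_While)
    show "Inv 0 s" by (auto simp: Inv_def s input_state_def rows_stored_def fun_eq_iff)
  next
    fix j s' assume j: "j < n" and inv: "Inv j s'"
    define s'' where "s'' = run weight_row_body s'"
    have pos: "4 * j + t < 4 * n" if "t < 4" for t using j that by linarith
    have succ: "row_successor n (4 * j) = 4 * j + 1" "row_successor n (4 * j + 1) = 4 * j + 2"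
      "row_successor n (4 * j + 2) = 4 * j + 3" "row_successor n (4 * j + 3) = 4 * j"
      using pos[of 0] pos[of 1] pos[of 2] pos[of 3] by (simp_all add: row_successor_def div_mod_4_simps)
    have block: "column_block n G (4 * j + t) = 4 * j + t" if "t < 4" for t
      using pos[OF that] by (simp add: column_block_def)
    have arr4: "arr s'' 4 = (arr s' 4)(4 * j := 4 * j + 1, 4 * j + 1 := 4 * j + 2,
        4 * j + 2 := 4 * j + 3, 4 * j + 3 := 4 * j)"
      and arr5: "arr s'' 5 = (arr s' 5)(4 * j := 4 * j, 4 * j + 1 := 4 * j + 1,
        4 * j + 2 := 4 * j + 2, 4 * j + 3 := 4 * j + 3)"
      using inv by (simp_all add: s''_def weight_row_body_def Inv_def)
    have "4 * Suc j = 4 * j + 4" by simp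
    hence "rows_stored n G (4 * Suc j) s''"
      unfolding rows_stored_def arr4 arr5 \<open>4 * Suc j = 4 * j + 4\<close>
      using inv succ block[of 0] block[of 1] block[of 2] block[of 3]
      by (intro conjI fill_four) (auto simp: Inv_def rows_stored_def)
    moreover have "rarr s'' 1 = (\<lambda>v. if v < 4 * Suc j then vertex_weight n w v else 0)"
    proof
      fix v
      have "rarr s'' 1 = (rarr s' 1)(4 * j := w j)"
        using inv j by (simp add: s''_def weight_row_body_def Inv_def s input_state_def)
      moreover have "vertex_weight n w v = (if v = 4 * j then w j else 0)"
        if "4 * j \<le> v" "v < 4 * Suc j"
      proof -
        have "v = 4 * j \<or> v = 4 * j + 1 \<or> v = 4 * j + 2 \<or> v = 4 * j + 3" using that by auto
        thus ?thesis using j by (auto simp: vertex_weight_def div_mod_4_simps)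
      qed
      ultimately show "rarr s'' 1 v = (if v < 4 * Suc j then vertex_weight n w v else 0)"
        using inv by (auto simp: Inv_def)
    qed
    moreover have "reg s'' 0 = n" "reg s'' 1 = k" "reg s'' 2 = 4 * Suc j" "reg s'' 3 = Suc j"
      "reg s'' 4 = 0" "reg s'' 6 = 0" "arr s'' 0 = arr s 0" "rarr s'' 0 = rarr s 0"
      using inv by (simp_all add: Inv_def s''_def weight_row_body_def)
    ultimately have "Inv (Suc j) s''" unfolding Inv_def by blast
    hence "reaches weight_row_body 12 s' (Inv (Suc j))"
      unfolding s''_def by (intro reaches_loop_free) (auto simp: weight_row_body_def)
    thus "bval (NLess (NReg 3) (NReg 0)) s' \<and> reaches weight_row_body 12 s' (Inv (Suc j))"
      using inv j by (simp add: Inv_def)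
  qed (auto simp: Inv_def)
  thus ?thesis
    by (rule reaches_mono) (auto simp: Inv_def vertex_weight_def fun_eq_iff)
qed

lemma input_generator_cell:
  assumes "i < k" "j < n"
  shows "arr (input_state k n G w) 0 (i * n + j) = of_bool (G $$ (i, j) = 1)"
proof -
  have "i * n + j < (i + 1) * n" using assms by simp
  also have "\<dots> \<le> k * n" using assms by (intro mult_right_mono) auto
  finally show ?thesis using assms by (simp add: input_state_def)
qed

lemma code_row_correct:
  assumes ij: "i < k" "0 < n"
    and s: "reg s 0 = n" "reg s 1 = k" "reg s 2 = (i + 1) * (4 * n)" "reg s 4 = i" "reg s 6 = i * n"
      "arr s 0 = arr (input_state k n G w) 0" "rarr s 1 = W" "rows_stored n G ((i + 1) * (4 * n)) s"
  shows "reaches code_row (n * 21 + 5) s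
    (\<lambda>s'. reg s' 0 = n \<and> reg s' 1 = k \<and> reg s' 2 = (i + 2) * (4 * n) \<and> reg s' 4 = i + 1 \<and>
      reg s' 6 = (i + 1) * n \<and> arr s' 0 = arr (input_state k n G w) 0 \<and> rarr s' 1 = W \<and>
      rows_stored n G ((i + 2) * (4 * n)) s')"
proof -
  define R where "R = (i + 1) * (4 * n)"
  define L where "L = R + (4 * n - 1)"
  \<comment> \<open>\<open>h\<close> describes the array before the last vertex \<open>L\<close> is
    corrected, so that the loop invariant needs no exception.\<close>
  define h where "h = (row_successor n)(L := L + 1)"
  define Inv where "Inv j s' \<longleftrightarrow> reg s' 0 = n \<and> reg s' 1 = k \<and> reg s' 2 = R + 4 * j \<and> reg s' 3 = j \<and>
      reg s' 4 = i \<and> reg s' 5 = R \<and> reg s' 6 = i * n + j \<and> arr s' 0 = arr (input_state k n G w) 0 \<and>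
      rarr s' 1 = W \<and> (\<forall>v<R + 4 * j. arr s' 4 v = h v) \<and> (\<forall>v<R + 4 * j. arr s' 5 v = column_block n G v)"
    for j and s' :: ram_state
  have h: "h (R + p) = R + p + 1" if "p < 4 * n" for p
    using row_successor_vertex[OF that, of "i + 1"] by (auto simp: h_def L_def R_def)
  have init: "Inv 0 (run (Seq (SetReg 5 (NReg 2)) (SetReg 3 (NConst 0))) s)"
    using s by (auto simp: Inv_def R_def h_def L_def rows_stored_def)
  \<comment> \<open>The 20 consists of 8 assignments, the closing \<open>Skip\<close>, and 11 for
    the conditional: two branches of 5 and the test.\<close>
  have inner: "reaches (While (NLess (NReg 3) (NReg 0)) code_row_body) (n * (20 + 1) + 1) s' (Inv n)"
    if "Inv 0 s'" for s'
  proof (rule reaches_While, rule that)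
    fix j s' assume j: "j < n" and inv: "Inv j s'"
    define s'' where "s'' = run code_row_body s'"
    define m where "m = R + 4 * j"
    have pos: "4 * j + t < 4 * n" if "t < 4" for t using j that by linarith
    have succ: "h m = m + 1" "h (m + 1) = m + 2" "h (m + 2) = m + 3" "h (m + 3) = m + 4"
      using h[OF pos[of 0]] h[OF pos[of 1]] h[OF pos[of 2]] h[OF pos[of 3]]
      by (simp_all add: m_def add.assoc)
    have block: "column_block n G (m + t) =
        (if G $$ (i, j) = 1 then 4 * j + t else if t < 2 then m + t else m + t - 2)" if "t < 4" for t
    proof -
      have "(4 * j + t) div 4 = j" "(4 * j + t) mod 4 = t" using that by auto
      thus ?thesis using column_block_vertex[OF pos[OF that], of G "i + 1"]
        by (simp add: m_def R_def add.assoc)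
    qed
    have cell: "arr s' 0 (i * n + j) = of_bool (G $$ (i, j) = 1)"
      using inv input_generator_cell[OF ij(1) j] by (simp add: Inv_def)
    have quad: "j + j + (j + j) = 4 * j" by simp
    have arr4: "arr s'' 4 = (arr s' 4)(m := m + 1, m + 1 := m + 2, m + 2 := m + 3, m + 3 := m + 4)"
      and arr5: "arr s'' 5 = (if G $$ (i, j) = 1
        then (arr s' 5)(m := 4 * j, m + 1 := 4 * j + 1, m + 2 := 4 * j + 2, m + 3 := 4 * j + 3)
        else (arr s' 5)(m := m, m + 1 := m + 1, m + 2 := m, m + 3 := m + 1))"
      using inv cell by (simp_all add: quad s''_def code_row_body_def Inv_def m_def)
    have m4: "R + 4 * Suc j = m + 4" by (simp add: m_def)
    have "\<forall>v<m + 4. arr s'' 4 v = h v"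
      unfolding arr4 using inv succ by (intro fill_four) (auto simp: Inv_def m_def)
    moreover have "\<forall>v<m + 4. arr s'' 5 v = column_block n G v"
    proof (cases "G $$ (i, j) = 1")
      case True
      show ?thesis unfolding arr5 if_P[OF True]
        using True inv block[of 0] block[of 1] block[of 2] block[of 3]
        by (intro fill_four) (auto simp: Inv_def m_def)
    next
      case False
      show ?thesis unfolding arr5 if_not_P[OF False]
        using False inv block[of 0] block[of 1] block[of 2] block[of 3]
        by (intro fill_four) (auto simp: Inv_def m_def)
    qed
    moreover have "reg s'' 0 = n" "reg s'' 1 = k" "reg s'' 2 = m + 4" "reg s'' 3 = Suc j"
      "reg s'' 4 = i" "reg s'' 5 = R" "reg s'' 6 = i * n + Suc j"
      "arr s'' 0 = arr (input_state k n G w) 0" "rarr s'' 1 = W"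
      using inv by (simp_all add: Inv_def s''_def code_row_body_def m_def)
    ultimately have "Inv (Suc j) s''" unfolding Inv_def m4 by blast
    hence "reaches code_row_body 20 s' (Inv (Suc j))"
      unfolding s''_def by (intro reaches_loop_free) (auto simp: code_row_body_def)
    thus "bval (NLess (NReg 3) (NReg 0)) s' \<and> reaches code_row_body 20 s' (Inv (Suc j))"
      using inv j by (simp add: Inv_def)
  qed (auto simp: Inv_def)
  have last: "reaches (Seq (SetArr 4 (NMinus (NReg 2) (NConst 1)) (NReg 5)) (incr 4 1)) 2 s'
    (\<lambda>s'. reg s' 0 = n \<and> reg s' 1 = k \<and> reg s' 2 = (i + 2) * (4 * n) \<and> reg s' 4 = i + 1 \<and>
      reg s' 6 = (i + 1) * n \<and> arr s' 0 = arr (input_state k n G w) 0 \<and> rarr s' 1 = W \<and>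
      rows_stored n G ((i + 2) * (4 * n)) s')"
    if inv: "Inv n s'" for s'
  proof (rule reaches_loop_free)
    define s'' where "s'' = run (Seq (SetArr 4 (NMinus (NReg 2) (NConst 1)) (NReg 5)) (incr 4 1)) s'"
    have R2: "(i + 2) * (4 * n) = R + 4 * n" by (simp add: R_def)
    have "row_successor n L = R"
      using row_successor_vertex[of "4 * n - 1" n "i + 1"] ij(2) by (simp add: L_def R_def)
    moreover have "arr s'' 4 = (arr s' 4)(L := R)"
      using inv ij(2) by (simp add: s''_def Inv_def L_def)
    ultimately have "\<forall>v<R + 4 * n. arr s'' 4 v = row_successor n v"
      using inv by (simp add: Inv_def h_def)
    moreover have "\<forall>v<R + 4 * n. arr s'' 5 v = column_block n G v"
      using inv by (simp add: s''_def Inv_def)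
    ultimately have "rows_stored n G (R + 4 * n) s''" unfolding rows_stored_def by blast
    moreover have "reg s'' 0 = n" "reg s'' 1 = k" "reg s'' 2 = R + 4 * n" "reg s'' 4 = i + 1"
      "reg s'' 6 = (i + 1) * n" "arr s'' 0 = arr (input_state k n G w) 0" "rarr s'' 1 = W"
      using inv by (simp_all add: Inv_def s''_def)
    ultimately show "reg s'' 0 = n \<and> reg s'' 1 = k \<and> reg s'' 2 = (i + 2) * (4 * n) \<and> reg s'' 4 = i + 1 \<and>
      reg s'' 6 = (i + 1) * n \<and> arr s'' 0 = arr (input_state k n G w) 0 \<and> rarr s'' 1 = W \<and>
      rows_stored n G ((i + 2) * (4 * n)) s''" unfolding R2 by blast
  qed auto
  have "reaches (Seq (SetReg 5 (NReg 2)) (SetReg 3 (NConst 0))) 2 s (Inv 0)"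
    by (rule reaches_loop_free[where Q = "Inv 0", OF _ _ init]) auto
  thus ?thesis unfolding code_row_def
  proof (rule reaches_Seq)
    fix s' assume "Inv 0 s'"
    from inner[OF this] show "reaches (Seq (While (NLess (NReg 3) (NReg 0)) code_row_body)
       (Seq (SetArr 4 (NMinus (NReg 2) (NConst 1)) (NReg 5)) (incr 4 1))) (n * 21 + 3) s'
      (\<lambda>s'. reg s' 0 = n \<and> reg s' 1 = k \<and> reg s' 2 = (i + 2) * (4 * n) \<and> reg s' 4 = i + 1 \<and>
      reg s' 6 = (i + 1) * n \<and> arr s' 0 = arr (input_state k n G w) 0 \<and> rarr s' 1 = W \<and>
      rows_stored n G ((i + 2) * (4 * n)) s')"
      by (rule reaches_Seq) (erule last, simp)
  qed simp
qed

text \<open>The arc part of \<open>outputs\<close> for a set of arcs listed so far, with weights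
  read off the fourth vertex.\<close>

definition arcs_listed :: "('v \<Rightarrow> real) \<Rightarrow> 'v arc set \<Rightarrow> (nat \<Rightarrow> 'v arc) \<Rightarrow> (nat \<Rightarrow> real) \<Rightarrow> nat \<Rightarrow> bool" where
  "arcs_listed wt S f g m \<longleftrightarrow> S = f ` {..<m} \<and> inj_on f {..<m} \<and> (\<forall>j<m. g j = wt (snd (snd (snd (f j)))))"

lemma arcs_listed_append:
  assumes "arcs_listed wt S f g m" "x \<notin> S"
    and "\<And>j. j < m \<Longrightarrow> f' j = f j \<and> g' j = g j" "f' m = x" "g' m = wt (snd (snd (snd x)))"
  shows "arcs_listed wt (insert x S) f' g' (Suc m)"
proof -
  have S: "S = f ` {..<m}" "inj_on f {..<m}" "\<forall>j<m. g j = wt (snd (snd (snd (f j))))"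
    using assms(1) by (auto simp: arcs_listed_def)
  have "f' ` {..<m} = S" unfolding S(1) using assms(3) by (intro image_cong) auto
  moreover have "inj_on f' {..<m}" using S(2) assms(3) by (simp add: inj_on_def)
  ultimately show ?thesis using assms(2-5) S(3)
    by (auto simp: arcs_listed_def lessThan_Suc less_Suc_eq)
qed

text \<open>Arcs are produced in lexicographic order of \<open>(c, a)\<close>. As this pair
  determines the arc, every test adds at most one arc, and it has not been listed before.\<close>

lemma arc_row_correct:
  assumes e: "e < N" and \<tau>: "\<And>v. v < N \<Longrightarrow> \<tau> v < N"
    and s: "reg s 0 = N" "reg s 3 = e" "\<forall>v<N. arr s 4 v = \<tau> v" "\<forall>v<N. arr s 5 v = \<beta> v" "rarr s 1 = wt"
      "arcs_listed wt {x \<in> block_arcs {..<N} \<tau> \<beta>. fst (snd (snd x)) < e} (output_arc s) (rarr s 0) (reg s 1)"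
  shows "reaches arc_row (N * 11 + 3) s
    (\<lambda>s'. reg s' 0 = N \<and> reg s' 3 = Suc e \<and> (\<forall>v<N. arr s' 4 v = \<tau> v) \<and> (\<forall>v<N. arr s' 5 v = \<beta> v) \<and>
      rarr s' 1 = wt \<and>
      arcs_listed wt {x \<in> block_arcs {..<N} \<tau> \<beta>. fst (snd (snd x)) < Suc e} (output_arc s') (rarr s' 0) (reg s' 1))"
    (is "reaches _ _ _ ?post")
proof -
  define S where "S a = {x \<in> block_arcs {..<N} \<tau> \<beta>.
      fst (snd (snd x)) < e \<or> fst (snd (snd x)) = e \<and> fst x < a}" for a
  define Inv where "Inv a s' \<longleftrightarrow> reg s' 0 = N \<and> reg s' 3 = e \<and> reg s' 4 = a \<and>
      (\<forall>v<N. arr s' 4 v = \<tau> v) \<and> (\<forall>v<N. arr s' 5 v = \<beta> v) \<and> rarr s' 1 = wt \<and>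
      arcs_listed wt (S a) (output_arc s') (rarr s' 0) (reg s' 1)" for a and s' :: ram_state
  have init: "Inv 0 (run (SetReg 4 (NConst 0)) s)"
    using s by (simp add: Inv_def S_def output_arc_def[abs_def])
  have inner: "reaches (While (NLess (NReg 4) (NReg 0)) arc_body) (N * (10 + 1) + 1) s' (Inv N)"
    if "Inv 0 s'" for s'
  proof (rule reaches_While, rule that)
    fix a s' assume a: "a < N" and inv: "Inv a s'"
    define s'' where "s'' = run arc_body s'"
    define x where "x = (a, \<tau> (\<tau> e), e, \<tau> e)"
    have val: "arr s' 4 e = \<tau> e" "arr s' 4 (\<tau> e) = \<tau> (\<tau> e)" "arr s' 5 (\<tau> e) = \<beta> (\<tau> e)" "arr s' 5 a = \<beta> a"
      using inv a e \<tau> by (auto simp: Inv_def)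
    have new: "x \<notin> S a" by (simp add: S_def x_def)
    have mem: "x \<in> block_arcs {..<N} \<tau> \<beta> \<longleftrightarrow> \<beta> a = \<beta> (\<tau> e) \<and> a \<noteq> \<tau> e"
      using a e by (simp add: x_def mem_block_arcs)
    have S_Suc: "S (Suc a) = (if x \<in> block_arcs {..<N} \<tau> \<beta> then insert x (S a) else S a)"
    proof -
      have new_iff: "y \<in> block_arcs {..<N} \<tau> \<beta> \<and> fst (snd (snd y)) = e \<and> fst y = a \<longleftrightarrow>
          x \<in> block_arcs {..<N} \<tau> \<beta> \<and> y = x" for y
      proof
        assume y: "y \<in> block_arcs {..<N} \<tau> \<beta> \<and> fst (snd (snd y)) = e \<and> fst y = a"
        obtain b d where "y = (a, b, e, d)" using y by (metis prod.collapse)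
        hence "y = x" using y by (simp add: x_def mem_block_arcs)
        thus "x \<in> block_arcs {..<N} \<tau> \<beta> \<and> y = x" using y by simp
      qed (simp add: x_def)
      have "y \<in> S (Suc a) \<longleftrightarrow> y \<in> S a \<or> (x \<in> block_arcs {..<N} \<tau> \<beta> \<and> y = x)" for y
        unfolding new_iff[symmetric] by (auto simp: S_def less_Suc_eq)
      thus ?thesis by (cases "x \<in> block_arcs {..<N} \<tau> \<beta>") auto
    qed
    have "arcs_listed wt (S (Suc a)) (output_arc s'') (rarr s'' 0) (reg s'' 1)"
    proof (cases "x \<in> block_arcs {..<N} \<tau> \<beta>")
      case True
      have "reg s'' 1 = Suc (reg s' 1)"
        using inv val True mem by (simp add: s''_def arc_body_def Inv_def)
      moreover have "output_arc s'' (reg s' 1) = x" "rarr s'' 0 (reg s' 1) = wt (snd (snd (snd x)))"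
        using inv val True mem by (simp_all add: s''_def arc_body_def Inv_def output_arc_def x_def)
      moreover have "output_arc s'' j = output_arc s' j" "rarr s'' 0 j = rarr s' 0 j" if "j < reg s' 1" for j
        using inv val True mem that by (simp_all add: s''_def arc_body_def Inv_def output_arc_def)
      ultimately show ?thesis
        using inv True new S_Suc arcs_listed_append[of wt "S a" "output_arc s'" "rarr s' 0" "reg s' 1" x
            "output_arc s''" "rarr s'' 0"] by (simp add: Inv_def)
    next
      case False
      have "reg s'' 1 = reg s' 1" "output_arc s'' = output_arc s'" "rarr s'' 0 = rarr s' 0"
        using inv val False mem by (auto simp: s''_def arc_body_def Inv_def output_arc_def[abs_def])
      thus ?thesis using inv False S_Suc by (simp add: Inv_def)
    qed
    moreover have "reg s'' 0 = N" "reg s'' 3 = e" "reg s'' 4 = Suc a" "\<forall>v<N. arr s'' 4 v = \<tau> v"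
      "\<forall>v<N. arr s'' 5 v = \<beta> v" "rarr s'' 1 = wt"
      using inv by (simp_all add: s''_def arc_body_def Inv_def)
    ultimately have "Inv (Suc a) s''" unfolding Inv_def by blast
    hence "reaches arc_body 10 s' (Inv (Suc a))"
      unfolding s''_def by (intro reaches_loop_free) (auto simp: arc_body_def)
    thus "bval (NLess (NReg 4) (NReg 0)) s' \<and> reaches arc_body 10 s' (Inv (Suc a))"
      using inv a by (simp add: Inv_def)
  qed (auto simp: Inv_def)
  have last: "reaches (incr 3 1) 1 s' ?post" if "Inv N s'" for s'
  proof -
    have "S N = {x \<in> block_arcs {..<N} \<tau> \<beta>. fst (snd (snd x)) < Suc e}"
      by (auto simp: S_def mem_block_arcs less_Suc_eq)
    thus ?thesis using that by (intro reaches_loop_free) (auto simp: Inv_def output_arc_def[abs_def])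
  qed
  have "reaches (SetReg 4 (NConst 0)) 1 s (Inv 0)"
    by (rule reaches_loop_free[where Q = "Inv 0", OF _ _ init]) auto
  thus ?thesis unfolding arc_row_def
  proof (rule reaches_Seq)
    fix s' assume "Inv 0 s'"
    from inner[OF this]
    show "reaches (Seq (While (NLess (NReg 4) (NReg 0)) arc_body) (incr 3 1)) (N * 11 + 2) s' ?post"
      by (rule reaches_Seq) (erule last, simp)
  qed simp
qed

lemma code_loop_correct:
  assumes nk: "n = 0 \<Longrightarrow> k = 0"
    and s: "reg s 0 = n" "reg s 1 = k" "reg s 2 = 4 * n" "reg s 4 = 0" "reg s 6 = 0"
      "arr s 0 = arr (input_state k n G w) 0" "rarr s 1 = W" "rows_stored n G (4 * n) s"
  shows "reaches (While (NLess (NReg 4) (NReg 1)) code_row) (k * (n * 21 + 6) + 1) s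
    (\<lambda>s'. reg s' 2 = 4 * n * (k + 1) \<and> rarr s' 1 = W \<and> rows_stored n G (4 * n * (k + 1)) s')"
proof -
  define Inv where "Inv i s' \<longleftrightarrow> reg s' 0 = n \<and> reg s' 1 = k \<and> reg s' 2 = (i + 1) * (4 * n) \<and>
      reg s' 4 = i \<and> reg s' 6 = i * n \<and> arr s' 0 = arr (input_state k n G w) 0 \<and> rarr s' 1 = W \<and>
      rows_stored n G ((i + 1) * (4 * n)) s'" for i and s' :: ram_state
  have "reaches (While (NLess (NReg 4) (NReg 1)) code_row) (k * (n * 21 + 5 + 1) + 1) s (Inv k)"
  proof (rule reaches_While)
    show "Inv 0 s" using s by (simp add: Inv_def)
  next
    fix i s' assume i: "i < k" and inv: "Inv i s'"
    \<comment> \<open>Without coordinates the correction in \<open>code_row\<close> would write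
      outside the empty row; the existence of a row rules this out through
      \<open>nk\<close>.\<close>
    have "0 < n" using i nk by (cases n) auto
    have "reaches code_row (n * 21 + 5) s' (Inv (Suc i))"
      by (rule reaches_mono[OF code_row_correct[where k = k and i = i and G = G and w = w and W = W]])
        (use i inv \<open>0 < n\<close> in \<open>simp_all add: Inv_def\<close>)
    thus "bval (NLess (NReg 4) (NReg 1)) s' \<and> reaches code_row (n * 21 + 5) s' (Inv (Suc i))"
      using i inv by (simp add: Inv_def)
  qed (simp add: Inv_def)
  moreover have "(k + 1) * (4 * n) = 4 * n * (k + 1)" by (rule mult.commute)
  ultimately show ?thesis
    by (elim reaches_mono) (simp_all only: Inv_def, simp)
qed

lemma arc_loop_correct:
  assumes \<tau>: "\<And>v. v < N \<Longrightarrow> \<tau> v < N"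
    and s: "reg s 0 = N" "reg s 1 = 0" "reg s 3 = 0" "\<forall>v<N. arr s 4 v = \<tau> v"
      "\<forall>v<N. arr s 5 v = \<beta> v" "rarr s 1 = wt"
  shows "reaches (While (NLess (NReg 3) (NReg 0)) arc_row) (N * (N * 11 + 4) + 1) s
    (\<lambda>s'. outputs s' {..<N} (block_arcs {..<N} \<tau> \<beta>) (\<lambda>(a, b, c, d). wt d))"
proof -
  define Inv where "Inv e s' \<longleftrightarrow> reg s' 0 = N \<and> reg s' 3 = e \<and> (\<forall>v<N. arr s' 4 v = \<tau> v) \<and>
      (\<forall>v<N. arr s' 5 v = \<beta> v) \<and> rarr s' 1 = wt \<and>
      arcs_listed wt {x \<in> block_arcs {..<N} \<tau> \<beta>. fst (snd (snd x)) < e} (output_arc s') (rarr s' 0) (reg s' 1)"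
    for e and s' :: ram_state
  have "reaches (While (NLess (NReg 3) (NReg 0)) arc_row) (N * (N * 11 + 3 + 1) + 1) s (Inv N)"
  proof (rule reaches_While)
    show "Inv 0 s" using s by (simp add: Inv_def arcs_listed_def)
  next
    fix e s' assume e: "e < N" and inv: "Inv e s'"
    have "reaches arc_row (N * 11 + 3) s' (Inv (Suc e))"
      unfolding Inv_def by (rule arc_row_correct) (use e inv \<tau> in \<open>simp_all add: Inv_def\<close>)
    thus "bval (NLess (NReg 3) (NReg 0)) s' \<and> reaches arc_row (N * 11 + 3) s' (Inv (Suc e))"
      using e inv by (simp add: Inv_def)
  qed (simp add: Inv_def)
  thus ?thesis
  proof (rule reaches_mono)
    fix s' assume inv: "Inv N s'"
    have "{x \<in> block_arcs {..<N} \<tau> \<beta>. fst (snd (snd x)) < N} = block_arcs {..<N} \<tau> \<beta>"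
      by (auto simp: block_arcs_def)
    thus "outputs s' {..<N} (block_arcs {..<N} \<tau> \<beta>) (\<lambda>(a, b, c, d). wt d)"
      using inv by (simp add: Inv_def outputs_def arcs_listed_def case_prod_unfold)
  qed simp
qed

lemma hypergraph_program_correct:
  assumes nk: "n = 0 \<Longrightarrow> k = 0" and N: "N = 4 * n * (k + 1)"
  shows "reaches hypergraph_program
    (n * 13 + 1 + (k * (n * 21 + 6) + 1 + (4 + (N * (N * 11 + 4) + 1)))) (input_state k n G w)
    (\<lambda>s'. outputs s' {..<N} (block_arcs {..<N} (row_successor n) (column_block n G))
      (\<lambda>(a, b, c, d). vertex_weight n w d))"
    (is "reaches _ _ ?s ?post")
  unfolding hypergraph_program_def
proof (rule reaches_Seq[OF weight_row_loop[OF refl]])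
  fix s' assume s': "reg s' 0 = n \<and> reg s' 1 = k \<and> reg s' 2 = 4 * n \<and> reg s' 4 = 0 \<and> reg s' 6 = 0 \<and>
      arr s' 0 = arr ?s 0 \<and> rarr s' 1 = vertex_weight n w \<and> rows_stored n G (4 * n) s'"
  have loop: "reaches (While (NLess (NReg 4) (NReg 1)) code_row) (k * (n * 21 + 6) + 1) s'
    (\<lambda>s'. reg s' 2 = N \<and> rarr s' 1 = vertex_weight n w \<and> rows_stored n G N s')"
    unfolding N by (rule code_loop_correct[OF nk]) (use s' in auto)
  have init: "reaches (seqs [SetReg 0 (NReg 2), SetReg 1 (NConst 0), SetReg 3 (NConst 0)]) 4 s
      (\<lambda>s'. reg s' 0 = N \<and> reg s' 1 = 0 \<and> reg s' 3 = 0 \<and> rarr s' 1 = vertex_weight n w \<and> rows_stored n G N s')"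
    if "reg s 2 = N \<and> rarr s 1 = vertex_weight n w \<and> rows_stored n G N s" for s
    using that by (intro reaches_loop_free) (auto simp: rows_stored_def)
  have arcs: "reaches (While (NLess (NReg 3) (NReg 0)) arc_row) (N * (N * 11 + 4) + 1) s ?post"
    if "reg s 0 = N \<and> reg s 1 = 0 \<and> reg s 3 = 0 \<and> rarr s 1 = vertex_weight n w \<and> rows_stored n G N s" for s
    by (rule arc_loop_correct) (use that row_successor_less[of _ n k] N in \<open>auto simp: rows_stored_def\<close>)
  show "reaches (Seq (While (NLess (NReg 4) (NReg 1)) code_row)
         (Seq (seqs [SetReg 0 (NReg 2), SetReg 1 (NConst 0), SetReg 3 (NConst 0)])
           (While (NLess (NReg 3) (NReg 0)) arc_row)))
     (k * (n * 21 + 6) + 1 + (4 + (N * (N * 11 + 4) + 1))) s' ?post"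
    by (rule reaches_Seq[OF loop reaches_Seq[OF init arcs] le_refl]) simp_all
qed simp

section \<open>The polynomial bound and the theorem\<close>

lemma card_block_arcs_le:
  assumes "finite V"
  shows "card (block_arcs V \<tau> \<beta>) \<le> card V * card V"
proof -
  have "inj_on (\<lambda>(a, b, c, d). (a, c)) (block_arcs V \<tau> \<beta>)"
    by (auto simp: inj_on_def block_arcs_def)
  moreover have "(\<lambda>(a, b, c, d). (a, c)) ` block_arcs V \<tau> \<beta> \<subseteq> V \<times> V"
    by (auto simp: block_arcs_def)
  ultimately have "card (block_arcs V \<tau> \<beta>) \<le> card (V \<times> V)"
    using assms by (intro card_inj_on_le) auto
  thus ?thesis by (simp add: card_cartesian_product)
qed

lemma constructs_within_hypergraph_program:
  assumes nk: "n = 0 \<Longrightarrow> k = 0" and N: "N = 4 * n * (k + 1)"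
  shows "constructs_within hypergraph_program (poly [:0, 0, 1000:] (input_size k n)) (input_state k n G w)
    {..<N} (block_arcs {..<N} (row_successor n) (column_block n G)) (\<lambda>(a, b, c, d). vertex_weight n w d)"
proof -
  define z where "z = input_size k n"
  \<comment> \<open>For \<open>n = 0\<close> and large \<open>k\<close> the rounds of the row loop
    would exceed any bound in the number of input cells; \<open>nk\<close> excludes this.\<close>
  have "k \<le> k * n" using nk by (cases n) auto
  moreover have "z = 2 + k * n + n" by (simp add: z_def input_size_def)
  moreover have "N = 4 * n + 4 * (k * n)" by (simp add: N algebra_simps)
  ultimately have z: "2 \<le> z" "n \<le> z" "k * n \<le> z" "k \<le> z" "N \<le> 4 * z" by linarith+
  have zz: "2 * z \<le> z * z" using z(1) by simp
  have NN: "N * N \<le> 16 * (z * z)" using mult_mono[OF z(5) z(5)] by simp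
  \<comment> \<open>The leading term \<open>11 * (N * N)\<close> is at most 176 times
    \<open>z * z\<close>; 1000 leaves ample room for the lower terms.\<close>
  have poly: "poly [:0, 0, 1000:] (input_size k n) = 1000 * (z * z)" by (simp add: z_def)
  have "n * 13 + 1 + (k * (n * 21 + 6) + 1 + (4 + (N * (N * 11 + 4) + 1))) =
      13 * n + 21 * (k * n) + 6 * k + 7 + 11 * (N * N) + 4 * N" by (simp add: algebra_simps)
  also have "\<dots> \<le> 1000 * (z * z)" using z zz NN by linarith
  finally have time: "n * 13 + 1 + (k * (n * 21 + 6) + 1 + (4 + (N * (N * 11 + 4) + 1))) \<le> 1000 * (z * z)" .
  have "card {..<N} + card (block_arcs {..<N} (row_successor n) (column_block n G)) \<le> N + N * N"
    using card_block_arcs_le[of "{..<N}" "row_successor n" "column_block n G"] by simp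
  also have "\<dots> \<le> 1000 * (z * z)" using z zz NN by linarith
  finally have size: "card {..<N} + card (block_arcs {..<N} (row_successor n) (column_block n G)) \<le> 1000 * (z * z)" .
  obtain T s' where "exec hypergraph_program (input_state k n G w) T s'"
      "T \<le> n * 13 + 1 + (k * (n * 21 + 6) + 1 + (4 + (N * (N * 11 + 4) + 1)))"
      "outputs s' {..<N} (block_arcs {..<N} (row_successor n) (column_block n G)) (\<lambda>(a, b, c, d). vertex_weight n w d)"
    using hypergraph_program_correct[OF nk N, of G w] unfolding reaches_def by blast
  thus ?thesis unfolding constructs_within_def poly
    using size time by (intro exI[of _ T] exI[of _ s']) auto
qed

theorem theorem2p3:
  shows "\<exists>(P :: com) (p :: nat poly).
    \<forall>(n :: nat) (k :: nat) (G :: bit mat) (C :: bit vec set) (w :: nat \<Rightarrow> real).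
      linear_code n C \<longrightarrow> generator_matrix k n G C \<longrightarrow>
      (\<exists>(V :: nat set) (A :: nat arc set) (t :: nat arc \<Rightarrow> real).
         constructs_within P (poly p (input_size k n)) (input_state k n G w) V A t \<and>
         directed_4hypergraph V A \<and>
         (\<exists>A' :: (nat, gpoly) mat4.
            is_signing A' (adjacency4 A t) \<and>
            (weight_enumerator C w = det4 V (\<lambda>a. identity4 a + A' a) \<or>
             weight_enumerator C w = - det4 V (\<lambda>a. identity4 a + A' a))))"
proof (intro exI[of _ hypergraph_program] exI[of _ "[:0, 0, 1000:]"] allI impI)
  fix n k :: nat and G :: "bit mat" and C :: "bit vec set" and w :: "nat \<Rightarrow> real"
  assume G: "generator_matrix k n G C"
  have nk: "k = 0" if "n = 0" using generator_matrix_length_0 G that by blast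
  define N where "N = 4 * n * (k + 1)"
  define \<tau> where "\<tau> = row_successor n"
  define \<beta> where "\<beta> = column_block n G"
  define A' where "A' = signed_block_arcs {..<N} \<tau> \<beta> (vertex_weight n w)"
  have "directed_4hypergraph {..<N} (block_arcs {..<N} \<tau> \<beta>)"
    using row_successor_less[of _ n k] row_successor_twice[of _ n k] column_block_row_successor[of _ n k]
    by (intro directed_4hypergraph_block_arcs) (auto simp: N_def \<tau>_def \<beta>_def)
  moreover have "is_signing A' (adjacency4 (block_arcs {..<N} \<tau> \<beta>) (\<lambda>(a, b, c, d). vertex_weight n w d))"
    unfolding A'_def by (rule is_signing_signed_block_arcs) simp
  \<comment> \<open>The alternative with the plus sign always holds, as every surviving set has
    coefficient 1.\<close>
  moreover have "weight_enumerator C w = det4 {..<N} (\<lambda>a. identity4 a + A' a)"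
    unfolding A'_def det4_signed_block_arcs[OF finite_lessThan inj_on_row_successor[of n k, folded N_def \<tau>_def]]
    using weight_enumerator_eq[OF G, of w] sum_even_invariant_sets[where n = n and k = k and G = G and w = w] nk
    by (simp only: N_def \<tau>_def \<beta>_def)
  moreover have "constructs_within hypergraph_program (poly [:0, 0, 1000:] (input_size k n))
      (input_state k n G w) {..<N} (block_arcs {..<N} \<tau> \<beta>) (\<lambda>(a, b, c, d). vertex_weight n w d)"
    unfolding \<tau>_def \<beta>_def by (rule constructs_within_hypergraph_program[OF nk N_def])
  ultimately show "\<exists>V A t. constructs_within hypergraph_program (poly [:0, 0, 1000:] (input_size k n))
      (input_state k n G w) V A t \<and> directed_4hypergraph V A \<and>
      (\<exists>A' :: (nat, gpoly) mat4. is_signing A' (adjacency4 A t) \<and>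
        (weight_enumerator C w = det4 V (\<lambda>a. identity4 a + A' a) \<or>
         weight_enumerator C w = - det4 V (\<lambda>a. identity4 a + A' a)))"
    by blast
qed

end
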